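(* Let $L\ge 4$ be an integer, $u>0$, $\tau>0$, and let $H_h$ and $H_I$ be the hopping and interaction Hamiltonians of the Hubbard model on the $L\times L$ square lattice with periodic boundary conditions. Then the second-order Trotter formulae obey, for $t\ge 0$, $$\left\| e^{i(H_h+H_I)t}-e^{i(t/2)H_h}\,e^{itH_I}\,e^{i(t/2)H_h}\right\|\le W_{SO1}\,t^3,$$ $$\left\| e^{i(H_h+H_I)t}-e^{i(t/2)H_I}\,e^{itH_h}\,e^{i(t/2)H_I}\right\|\le W_{SO2}\,t^3,$$ where the constants $W_{SO1},W_{SO2}$ (independent of $t$) satisfy $$W_{SO1}\le \frac{u^2}{12}\,\|H_h\|+\frac{u\tau^2}{12}\,L^2(\sqrt5+8),\qquad W_{SO2}\le \frac{u\tau^2}{6}\,L^2(\sqrt5+8)+\frac{u^2}{24}\,\|H_h\|.$$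
   Context: The lattice sites are the elements of $(\mathbb{Z}/L\mathbb{Z})^2$; two sites are nearest neighbours if they differ by $(\pm1,0)$ or $(0,\pm1)$ modulo $L$. For each site $i$ and spin $\sigma\in\{\uparrow,\downarrow\}$ there is a fermionic mode with annihilation operator $a_{i,\sigma}$ and creation operator $a_{i,\sigma}^\dagger$, satisfying the canonical anticommutation relations on the $2^{2L^2}$-dimensional Fock space. Put $\hat n_{i,\sigma}=a_{i,\sigma}^\dagger a_{i,\sigma}$ and $\hat z_{i,\sigma}=2\hat n_{i,\sigma}-\mathbb{1}$. The hopping Hamiltonian is $H_h=\sum_{\sigma}\sum_{i\ne j}R_{i,j}\,a_{i,\sigma}^\dagger a_{j,\sigma}$, the inner sum being over ordered pairs of distinct sites, where $R_{i,j}=\tau$ if $i,j$ are nearest neighbours and $R_{i,j}=0$ otherwise. The (chemical-potential-shifted) interaction Hamiltonian is $H_I=\frac{u}{4}\sum_i \hat z_{i,\uparrow}\hat z_{i,\downarrow}$. $\|\cdot\|$ is the operator norm. The constants are the standard second-order commutator expressions $W_{SO1}=\frac1{12}\|[[H_h,H_I],H_I]\|+\frac1{24}\|[[H_h,H_I],H_h]\|$ and $W_{SO2}=\frac1{12}\|[[H_I,H_h],H_h]\|+\frac1{24}\|[[H_I,H_h],H_I]\|$, with $[A,B]=AB-BA$. *)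

theory Defs
  imports "HOL-Analysis.Analysis" "HOL-Number_Theory.Cong"
begin

section \<open>Complex matrices as operators\<close>

text \<open>
  Operators on the Hilbert space \<open>complex ^ 'f\<close> are matrices. The type class operations
  \<open>*\<close> and \<open>norm\<close> on this type are the entrywise product and a Frobenius-type norm;
  they are not used here. Composition is \<open>**\<close>, and the norm is the operator norm below
  (\<open>complex ^ 'f\<close> itself carries the usual Hermitian norm).
\<close>

type_synonym 'f op = "complex ^ 'f ^ 'f"

definition adj :: "'f::finite op \<Rightarrow> 'f op" where
  "adj A = map_matrix cnj (transpose A)"

definition cscale :: "complex \<Rightarrow> 'f::finite op \<Rightarrow> 'f op" where
  "cscale c A = map_matrix ((*) c) A"

definition opnorm :: "'f::finite op \<Rightarrow> real" where
  "opnorm A = onorm (\<lambda>x. A *v x)"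

definition comm :: "'f::finite op \<Rightarrow> 'f op \<Rightarrow> 'f op" where
  "comm A B = A ** B - B ** A"

definition anticomm :: "'f::finite op \<Rightarrow> 'f op \<Rightarrow> 'f op" where
  "anticomm A B = A ** B + B ** A"

definition mexp :: "'f::finite op \<Rightarrow> 'f op" where
  "mexp A = (\<Sum>n. (1 / fact n) *\<^sub>R (((**) A) ^^ n) (mat 1))"

abbreviation expi :: "real \<Rightarrow> 'f::finite op \<Rightarrow> 'f op" where
  "expi t A \<equiv> mexp (cscale (\<i> * of_real t) A)"


section \<open>The periodic square lattice\<close>

datatype spin = Up | Down

type_synonym site = "int \<times> int"
type_synonym fmode = "site \<times> spin"

text \<open>Elements of \<open>\<int>/L\<int>\<close> are represented by their residues in \<open>{0..<L}\<close>.\<close>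

definition sites :: "nat \<Rightarrow> site set" where
  "sites L = {0..<int L} \<times> {0..<int L}"

definition modes :: "nat \<Rightarrow> fmode set" where
  "modes L = sites L \<times> {Up, Down}"

definition nearest_neighbours :: "nat \<Rightarrow> site \<Rightarrow> site \<Rightarrow> bool" where
  "nearest_neighbours L i j \<longleftrightarrow>
     (\<exists>(dx, dy) \<in> {(1, 0), (- 1, 0), (0, 1), (0, - 1)}.
        [fst i = fst j + dx] (mod int L) \<and> [snd i = snd j + dy] (mod int L))"


section \<open>Canonical anticommutation relations\<close>

text \<open>
  The creation operator of a mode is the adjoint of its annihilation operator, so the
  relations between two creation operators follow from those between annihilation operators.
\<close>

definition CAR :: "'m set \<Rightarrow> ('m \<Rightarrow> 'f::finite op) \<Rightarrow> bool" where
  "CAR M a \<longleftrightarrow>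
     (\<forall>p\<in>M. \<forall>q\<in>M. anticomm (a p) (a q) = 0 \<and>
        anticomm (a p) (adj (a q)) = (if p = q then mat 1 else 0))"


section \<open>The Hubbard Hamiltonians\<close>

definition number_op :: "(fmode \<Rightarrow> 'f::finite op) \<Rightarrow> site \<Rightarrow> spin \<Rightarrow> 'f op" where
  "number_op a i \<sigma> = adj (a (i, \<sigma>)) ** a (i, \<sigma>)"

definition z_op :: "(fmode \<Rightarrow> 'f::finite op) \<Rightarrow> site \<Rightarrow> spin \<Rightarrow> 'f op" where
  "z_op a i \<sigma> = 2 *\<^sub>R number_op a i \<sigma> - mat 1"

definition hop_coeff :: "nat \<Rightarrow> real \<Rightarrow> site \<Rightarrow> site \<Rightarrow> real" where
  "hop_coeff L \<tau> i j = (if nearest_neighbours L i j then \<tau> else 0)"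

definition H_hop :: "nat \<Rightarrow> (fmode \<Rightarrow> 'f::finite op) \<Rightarrow> real \<Rightarrow> 'f op" where
  "H_hop L a \<tau> =
     (\<Sum>\<sigma>\<in>{Up, Down}. \<Sum>(i, j)\<in>{(i, j). i \<in> sites L \<and> j \<in> sites L \<and> i \<noteq> j}.
        hop_coeff L \<tau> i j *\<^sub>R (adj (a (i, \<sigma>)) ** a (j, \<sigma>)))"

definition H_int :: "nat \<Rightarrow> (fmode \<Rightarrow> 'f::finite op) \<Rightarrow> real \<Rightarrow> 'f op" where
  "H_int L a u = (u / 4) *\<^sub>R (\<Sum>i\<in>sites L. z_op a i Up ** z_op a i Down)"


section \<open>The second-order commutator constants\<close>

definition W_SO1 :: "'f::finite op \<Rightarrow> 'f op \<Rightarrow> real" where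
  "W_SO1 Hh HI =
     1 / 12 * opnorm (comm (comm Hh HI) HI) + 1 / 24 * opnorm (comm (comm Hh HI) Hh)"

definition W_SO2 :: "'f::finite op \<Rightarrow> 'f op \<Rightarrow> real" where
  "W_SO2 Hh HI =
     1 / 12 * opnorm (comm (comm HI Hh) Hh) + 1 / 24 * opnorm (comm (comm HI Hh) HI)"


section \<open>Existence of the Fock representation\<close>

text \<open>
  The relations are satisfiable on a space of dimension \<open>2 ^ card M\<close>. The basis is
  indexed by the subsets of \<open>M\<close>, and \<open>a p\<close> removes \<open>p\<close> with the
  Jordan-Wigner sign, given by the number of occupied modes preceding \<open>p\<close>.
\<close>

definition jw_sign :: "('m \<Rightarrow> nat) \<Rightarrow> 'm \<Rightarrow> 'm set \<Rightarrow> complex" where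
  "jw_sign g p S = (\<Prod>k\<in>S. if g k < g p then - 1 else 1)"

lemma jw_sign_insert:
  "finite S \<Longrightarrow> k \<notin> S \<Longrightarrow>
     jw_sign g p (insert k S) = (if g k < g p then - 1 else 1) * jw_sign g p S"
  by (simp add: jw_sign_def)

lemma jw_sign_sq: "jw_sign g p S * jw_sign g p S = 1"
  by (simp add: jw_sign_def flip: prod.distrib) (rule prod.neutral, auto)

lemma cnj_jw_sign [simp]: "cnj (jw_sign g p S) = jw_sign g p S"
  by (simp add: jw_sign_def) (rule prod.cong, auto)

lemma CAR_exists:
  fixes M :: "'m set"
  assumes fin: "finite M" and card: "CARD('f::finite) = 2 ^ card M"
  shows "\<exists>a :: 'm \<Rightarrow> 'f op. CAR M a"
proof -
  have "card (UNIV :: 'f set) = card (Pow M)" using fin card by (simp add: card_Pow)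
  then obtain e :: "'f \<Rightarrow> 'm set" where e: "bij_betw e UNIV (Pow M)"
    using fin by (metis finite finite_Pow_iff finite_same_card_bij)
  obtain g :: "'m \<Rightarrow> nat" where g: "inj_on g M"
    using fin finite_imp_inj_to_nat_seg by metis
  define r where "r = inv_into UNIV e"
  have er: "e (r S) = S" if "S \<subseteq> M" for S
    using e that unfolding r_def bij_betw_def by (metis PowI f_inv_into_f)
  have re: "r (e x) = x" for x
    using e unfolding r_def bij_betw_def by simp
  have eM: "e x \<subseteq> M" for x using e by (auto simp: bij_betw_def)
  have efin: "finite (e x)" for x using eM fin finite_subset by blast
  have eq: "e x = S \<longleftrightarrow> x = r S" if "S \<subseteq> M" for x S using er re that by auto
  define a :: "'m \<Rightarrow> 'f op" where
    "a = (\<lambda>p. \<chi> x y. if p \<in> e y \<and> e x = e y - {p} then jw_sign g p (e y) else 0)"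
  have a1: "a p $ x $ y =
      (if x = r (e y - {p}) then if p \<in> e y then jw_sign g p (e y) else 0 else 0)" for p x y
    using eq[of "e y - {p}" x] eM[of y] by (auto simp: a_def)
  have a2: "adj (a p) $ x $ y = (if x = r (insert p (e y)) then
      if p \<notin> e y then jw_sign g p (e y) else 0 else 0)" if "p \<in> M" for p x y
  proof -
    have "p \<in> e x \<and> e y = e x - {p} \<longleftrightarrow> p \<notin> e y \<and> e x = insert p (e y)" by auto
    moreover have "e x = insert p (e y) \<longleftrightarrow> x = r (insert p (e y))"
      using eq[of "insert p (e y)" x] eM[of y] that by auto
    moreover have "jw_sign g p (insert p (e y)) = jw_sign g p (e y)" if "p \<notin> e y"
      using that efin by (simp add: jw_sign_insert)
    moreover have "e x = insert p (e y)" if "x = r (insert p (e y))"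
      using that eM[of y] \<open>p \<in> M\<close> by (simp add: er)
    ultimately show ?thesis
      by (auto simp: adj_def transpose_def a_def)
  qed
  have col: "(A ** B) $ x $ y = A $ x $ z * c"
    if "\<And>w. B $ w $ y = (if w = z then c else 0)" for A B :: "'f op" and x y z c
    using that by (simp add: matrix_matrix_mult_def if_distrib[of "\<lambda>v. _ * v"] cong: if_cong)
  have aa: "(a p ** a q) $ x $ y = (if x = r (e y - {q} - {p}) then
      if q \<in> e y \<and> p \<in> e y - {q} then jw_sign g p (e y - {q}) * jw_sign g q (e y) else 0 else 0)"
    for p q x y
  proof -
    have "e (r (e y - {q})) = e y - {q}" by (rule er) (use eM in blast)
    then show ?thesis by (simp add: col[OF a1[of q]] a1[of p])
  qed
  have ac: "(a p ** adj (a q)) $ x $ y = (if x = r (insert q (e y) - {p}) then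
      if q \<notin> e y \<and> p \<in> insert q (e y) then jw_sign g p (insert q (e y)) * jw_sign g q (e y) else 0 else 0)"
    if "q \<in> M" for p q x y
  proof -
    have "e (r (insert q (e y))) = insert q (e y)" by (rule er) (use eM that in blast)
    then show ?thesis by (simp add: col[OF a2[OF that]] a1[of p])
  qed
  have ca: "(adj (a q) ** a p) $ x $ y = (if x = r (insert q (e y - {p})) then
      if p \<in> e y \<and> q \<notin> e y - {p} then jw_sign g q (e y - {p}) * jw_sign g p (e y) else 0 else 0)"
    if "q \<in> M" for p q x y
  proof -
    have "e (r (e y - {p})) = e y - {p}" by (rule er) (use eM in blast)
    then show ?thesis by (simp add: col[OF a1[of p]] a2[OF that])
  qed
  have rem: "jw_sign g q S = (if g p < g q then - 1 else 1) * jw_sign g q (S - {p})"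
    if "finite S" "p \<in> S" for p q S
    using jw_sign_insert[of "S - {p}" p g q] that by (simp add: insert_absorb)
  have anti: "anticomm (a p) (a q) = 0" if "p \<in> M" "q \<in> M" for p q
  proof -
    have "(a p ** a q) $ x $ y + (a q ** a p) $ x $ y = 0" for x y
    proof (cases "p \<in> e y \<and> q \<in> e y \<and> p \<noteq> q")
      case True
      then have pq: "p \<in> e y" "q \<in> e y" "p \<noteq> q" "q \<noteq> p" by auto
      then have "g p \<noteq> g q" using g that by (auto dest: inj_onD)
      then have sgn: "(if g p < g q then - 1 else 1) = - (if g q < g p then - 1 else 1 :: complex)"
        by auto
      have "e y - {p} - {q} = e y - {q} - {p}" by auto
      moreover have q: "jw_sign g q (e y) = (if g p < g q then - 1 else 1) * jw_sign g q (e y - {p})"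
        by (rule rem[OF efin]) (simp add: True)
      moreover have p: "jw_sign g p (e y) = (if g q < g p then - 1 else 1) * jw_sign g p (e y - {q})"
        by (rule rem[OF efin]) (simp add: True)
      ultimately show ?thesis
        using pq unfolding aa p q sgn by simp
    next
      case False
      then have "\<not> (q \<in> e y \<and> p \<in> e y - {q})" "\<not> (p \<in> e y \<and> q \<in> e y - {p})" by auto
      then show ?thesis by (simp only: aa if_False if_cancel add_0)
    qed
    then show ?thesis by (simp add: anticomm_def vec_eq_iff)
  qed
  have mixed: "anticomm (a p) (adj (a q)) = (if p = q then mat 1 else 0)"
    if "p \<in> M" "q \<in> M" for p q
  proof -
    have "(a p ** adj (a q)) $ x $ y + (adj (a q) ** a p) $ x $ y
        = (if p = q then mat 1 $ x $ y else 0)" for x y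
    proof (cases "p = q")
      case True
      show ?thesis
      proof (cases "p \<in> e y")
        case True
        then have "jw_sign g p (e y - {p}) = jw_sign g p (e y)" "insert p (e y - {p}) = e y"
          using rem[OF efin True, of p] by auto
        then show ?thesis
          using True unfolding \<open>p = q\<close>[symmetric] ac[OF that(1)] ca[OF that(1)]
          by (simp add: re mat_def jw_sign_sq)
      next
        case False
        then have "jw_sign g p (insert p (e y)) = jw_sign g p (e y)" "insert p (e y) - {p} = e y"
          using jw_sign_insert[OF efin False, of g p] by auto
        then show ?thesis
          using False unfolding \<open>p = q\<close>[symmetric] ac[OF that(1)] ca[OF that(1)]
          by (simp add: re mat_def jw_sign_sq)
      qed
    next
      case False
      then have "g p \<noteq> g q" using g that by (auto dest: inj_onD)
      then have sgn: "(if g p < g q then - 1 else 1) = - (if g q < g p then - 1 else 1 :: complex)"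
        by auto
      have comm: "insert q (e y) - {p} = insert q (e y - {p})" using False by auto
      show ?thesis
      proof (cases "p \<in> e y \<and> q \<notin> e y")
        case True
        then have q: "jw_sign g q (e y) = (if g p < g q then - 1 else 1) * jw_sign g q (e y - {p})"
          by (intro rem[OF efin]) simp
        have p: "jw_sign g p (insert q (e y)) = (if g q < g p then - 1 else 1) * jw_sign g p (e y)"
          using True by (intro jw_sign_insert[OF efin]) simp
        show ?thesis
          using True False unfolding ac[OF that(2)] ca[OF that(2)] comm p q sgn by simp
      next
        case no: False
        then have "\<not> (q \<notin> e y \<and> p \<in> insert q (e y))" "\<not> (p \<in> e y \<and> q \<notin> e y - {p})"
          using False by auto
        then show ?thesis
          using False by (simp only: ac[OF that(2)] ca[OF that(2)] if_False if_cancel add_0)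
      qed
    qed
    then show ?thesis by (simp add: anticomm_def vec_eq_iff)
  qed
  show ?thesis using anti mixed unfolding CAR_def by blast
qed

lemma card_modes: "card (modes L) = 2 * L ^ 2"
  by (simp add: modes_def sites_def card_cartesian_product power2_eq_square)

corollary CAR_modes_exists:
  assumes "CARD('f::finite) = 2 ^ (2 * L ^ 2)"
  shows "\<exists>a :: fmode \<Rightarrow> 'f op. CAR (modes L) a"
  using assms by (intro CAR_exists) (simp_all only: card_modes, simp add: modes_def sites_def)

end

theory Submission
  imports Defs
begin

text \<open>
  The cubic error of the symmetric splitting \<open>S(t) = e\<^bsup>tX/2\<^esup> e\<^bsup>tY\<^esup> e\<^bsup>tX/2\<^esup>\<close> comes from
  \<open>S' = e\<^bsup>tX/2\<^esup> e\<^bsup>tY\<^esup> (X/2 + Y + e\<^bsup>-tY\<^esup> (X/2) e\<^bsup>tY\<^esup>) e\<^bsup>tX/2\<^esup>\<close>: comparing with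
  \<open>S (X + Y)\<close> leaves a defect that vanishes to second order at \<open>0\<close> and whose second derivative
  is a sum of unitary conjugates of \<open>[[X,Y],Y]/2\<close> and \<open>[[X,Y],X]/4\<close>.

  For \<open>A = H\<^sub>I / u\<close>, a hopping term \<open>T = a\<^sub>i\<^sup>\<dagger> a\<^sub>j\<close> satisfies \<open>[T, A] = T w\<close> with
  \<open>w = (z\<^sub>j - z\<^sub>i) / 2\<close> (the \<open>z\<close> of the other spin), and \<open>w\<^sup>3 = w\<close>. So \<open>ad A\<close> has eigenvalues
  in \<open>{-1, 0, 1}\<close> on \<open>H\<^sub>h\<close>, conjugation by \<open>e\<^bsup>i \<pi> A\<^esup>\<close> acts as \<open>1 - 2 (ad A)\<^sup>2\<close>, and
  \<open>\<parallel>[[H\<^sub>h, A], A]\<parallel> \<le> \<parallel>H\<^sub>h\<parallel>\<close>.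

  For the other commutator, \<open>[[z\<^sub>\<up> z\<^sub>\<down>, H\<^sub>h], H\<^sub>h]\<close> is estimated site by site. With
  \<open>b = [a, H\<^sub>h]\<close>, \<open>f = [b, H\<^sub>h]\<close> and \<open>K = a\<^sup>\<dagger> b - b\<^sup>\<dagger> a\<close> one has \<open>[z, H\<^sub>h] = 2 K\<close> and
  \<open>[K, H\<^sub>h] = a\<^sup>\<dagger> f + f\<^sup>\<dagger> a - 2 b\<^sup>\<dagger> b\<close>. Splitting off from \<open>f\<close> the component along \<open>a\<close>
  and using anticommutation, \<open>\<parallel>K\<parallel> \<le> 2 \<tau>\<close> and \<open>\<parallel>[K, H\<^sub>h]\<parallel> \<le> 12 \<tau>\<^sup>2\<close>, so each site contributes at
  most \<open>80 \<tau>\<^sup>2\<close>, and \<open>80 \<le> 8 (\<surd>5 + 8)\<close>. Only 4-regularity of the lattice enters, so that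
  \<open>L = 4\<close>, where second neighbours coincide, needs no separate treatment.
\<close>


section \<open>Symmetric splitting in Banach algebras\<close>

definition rcomm :: "'a::ring \<Rightarrow> 'a \<Rightarrow> 'a" where
  "rcomm x y = x * y - y * x"

lemma norm_mult_le: "norm (x * y) \<le> b * c" if "norm x \<le> b" "norm y \<le> c" for x y :: "'a::real_normed_algebra"
  using that by (meson mult_mono norm_ge_zero norm_mult_ineq order_trans)

lemma rcomm_simps:
  "rcomm (x + y) w = rcomm x w + rcomm y w" "rcomm w (x + y) = rcomm w x + rcomm w y"
  "rcomm (x - y) w = rcomm x w - rcomm y w" "rcomm (- x) w = - rcomm x w"
  "rcomm (x * y) w = rcomm x w * y + x * rcomm y w" "rcomm w (x * y) = rcomm w x * y + x * rcomm w y"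
  by (simp_all add: rcomm_def algebra_simps)

lemma rcomm_scaleR:
  "rcomm (r *\<^sub>R x) w = r *\<^sub>R rcomm x w" "rcomm w (r *\<^sub>R x) = r *\<^sub>R rcomm w x" for x w :: "'a::real_algebra"
  by (simp_all add: rcomm_def algebra_simps)

lemma rcomm_one [simp]: "rcomm 1 w = 0" "rcomm w 1 = 0" for w :: "'a::ring_1"
  by (simp_all add: rcomm_def)

lemma rcomm_sum: "rcomm (\<Sum>i\<in>I. f i) w = (\<Sum>i\<in>I. rcomm (f i) w)" "rcomm w (\<Sum>i\<in>I. f i) = (\<Sum>i\<in>I. rcomm w (f i))"
  by (simp_all add: rcomm_def sum_distrib_left sum_distrib_right sum_subtractf)

text \<open>With \<open>X\<close> written on the inner side of both exponentials, their derivatives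
  combine into a commutator around \<open>f t\<close>.\<close>

lemma exp_conj_has_vector_derivative:
  fixes X :: "'a::{real_normed_algebra_1,banach}"
  assumes "(f has_vector_derivative f') (at t)"
  shows "((\<lambda>t. exp (t *\<^sub>R X) * f t * exp (- (t *\<^sub>R X)))
     has_vector_derivative exp (t *\<^sub>R X) * (f' + rcomm X (f t)) * exp (- (t *\<^sub>R X))) (at t)"
proof -
  have "((\<lambda>t. exp (t *\<^sub>R (- X))) has_vector_derivative (- X) * exp (t *\<^sub>R (- X))) (at t)"
    by (rule exp_scaleR_has_vector_derivative_left)
  then have 1: "((\<lambda>t. exp (- (t *\<^sub>R X))) has_vector_derivative - (X * exp (- (t *\<^sub>R X)))) (at t)"
    by simp
  show ?thesis
    by (rule has_vector_derivative_eq_rhs)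
      (rule has_vector_derivative_mult has_vector_derivative_mult exp_scaleR_has_vector_derivative_right assms 1
       | simp add: rcomm_def algebra_simps)+
qed

lemma exp_cancel [simp]:
  fixes x :: "'a::{real_normed_algebra_1,banach}"
  shows "exp x * exp (- x) = 1" "exp (- x) * exp x = 1"
    "exp x * (exp (- x) * z) = z" "exp (- x) * (exp x * z) = z"
  using exp_minus_inverse[of x] exp_minus_inverse[of "- x"] by (simp_all flip: mult.assoc)

lemma norm_exp_conj_le:
  fixes x y :: "'a::{real_normed_algebra_1,banach}"
  assumes "norm (exp x) \<le> 1" "norm (exp (- x)) \<le> 1"
  shows "norm (exp x * y * exp (- x)) \<le> norm y"
proof -
  have "norm (exp x * y * exp (- x)) \<le> norm (exp x) * norm y * norm (exp (- x))"
    by (meson mult_right_mono norm_ge_zero norm_mult_ineq order_trans)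
  also have "\<dots> \<le> 1 * norm y * 1"
    using assms by (intro mult_mono) auto
  finally show ?thesis by simp
qed

text \<open>By \<open>per\<close> the flow of \<open>Y\<close> under commutation with
  \<open>X\<close> closes on three terms and is trigonometric. At time \<pi> it equals
  \<open>Y\<close> plus twice the double commutator; being a conjugate of \<open>Y\<close> by
  contractions, it has norm at most \<open>norm Y\<close>, and the triangle inequality gives the
  constant 1.\<close>

lemma norm_double_rcomm_le:
  fixes X Y :: "'a::{real_normed_algebra_1,banach}"
  assumes X: "\<And>s::real. norm (exp (s *\<^sub>R X)) \<le> 1"
    and per: "rcomm (rcomm (rcomm Y X) X) X = - rcomm Y X"
  shows "norm (rcomm (rcomm Y X) X) \<le> norm Y"
proof -
  \<comment> \<open>The solution of F' = [F, X] with F(0) = Y in closed form; hence \<open>G\<close>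
    below is constant.\<close>
  define F where "F s = Y + sin s *\<^sub>R rcomm Y X + (1 - cos s) *\<^sub>R rcomm (rcomm Y X) X" for s :: real
  define G where "G s = exp (s *\<^sub>R X) * F s * exp (- (s *\<^sub>R X))" for s
  have F': "(F has_vector_derivative rcomm (F s) X) (at s)" for s
  proof -
    have "(F has_vector_derivative cos s *\<^sub>R rcomm Y X + sin s *\<^sub>R rcomm (rcomm Y X) X) (at s)"
      unfolding F_def by (auto intro!: derivative_eq_intros)
    moreover have "rcomm (F s) X = rcomm Y X + sin s *\<^sub>R rcomm (rcomm Y X) X
        + (1 - cos s) *\<^sub>R rcomm (rcomm (rcomm Y X) X) X"
      by (simp add: F_def rcomm_def algebra_simps)
    ultimately show ?thesis by (simp add: per algebra_simps)
  qed
  have "(G has_vector_derivative 0) (at s within UNIV)" for s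
    unfolding G_def using exp_conj_has_vector_derivative[OF F', of X s]
    by (simp add: rcomm_def)
  then obtain c where "\<And>s. G s = c"
    using has_vector_derivative_zero_constant[of UNIV G] by auto
  then have "G pi = G 0" by simp
  then have "exp (pi *\<^sub>R X) * F pi * exp (- (pi *\<^sub>R X)) = Y"
    by (simp add: G_def F_def)
  then have "F pi = exp (- (pi *\<^sub>R X)) * Y * exp (pi *\<^sub>R X)"
    by (metis (no_types, lifting) exp_cancel(2) exp_cancel(4) mult.assoc mult.right_neutral)
  moreover have "norm (exp (- (pi *\<^sub>R X)) * Y * exp (- (- (pi *\<^sub>R X)))) \<le> norm Y"
    using X[of pi] X[of "- pi"] by (intro norm_exp_conj_le) auto
  ultimately have "norm (F pi) \<le> norm Y" by simp
  moreover have "2 *\<^sub>R rcomm (rcomm Y X) X = F pi - Y" by (simp add: F_def)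
  ultimately have "norm (2 *\<^sub>R rcomm (rcomm Y X) X) \<le> norm Y + norm Y"
    by (metis add_right_mono norm_triangle_ineq4 order_trans)
  then show ?thesis by simp
qed

text \<open>The mean value inequality as a comparison principle: three successive uses integrate a
  bound on the second derivative of the splitting defect up to the cubic error.\<close>

lemma norm_le_of_vector_derivative_le:
  fixes f :: "real \<Rightarrow> 'a::real_normed_vector"
  assumes "\<And>x. (f has_vector_derivative f' x) (at x)" "\<And>x. (g has_vector_derivative g' x) (at x)"
    and "\<And>x. x \<ge> 0 \<Longrightarrow> norm (f' x) \<le> g' x" and "f 0 = 0" "g 0 = 0" "t \<ge> 0"
  shows "norm (f t) \<le> g t"
proof (cases "t = 0")
  case False
  have "norm (f t - f 0) \<le> g t - g 0"
    by (rule differentiable_bound_general)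
      (use assms False in \<open>auto intro!: continuous_at_imp_continuous_on has_vector_derivative_continuous\<close>)
  then show ?thesis using assms by simp
qed (use assms in simp)

proposition strang_splitting_error:
  fixes X Y :: "'a::{real_normed_algebra_1,banach}"
  assumes X: "\<And>s::real. norm (exp (s *\<^sub>R X)) \<le> 1" and Y: "\<And>s::real. norm (exp (s *\<^sub>R Y)) \<le> 1"
    and XY: "\<And>s::real. norm (exp (s *\<^sub>R (X + Y))) \<le> 1" and t: "t \<ge> 0"
  shows "norm (exp (t *\<^sub>R (X + Y)) - exp ((t / 2) *\<^sub>R X) * exp (t *\<^sub>R Y) * exp ((t / 2) *\<^sub>R X))
     \<le> (1 / 12 * norm (rcomm (rcomm X Y) Y) + 1 / 24 * norm (rcomm (rcomm X Y) X)) * t ^ 3"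
proof -
  \<comment> \<open>A bound on the second derivative of the defect \<open>E\<close>; the final c/6
    produces 1/12 and 1/24.\<close>
  define c where "c = norm (rcomm (rcomm X Y) Y) / 2 + norm (rcomm (rcomm X Y) X) / 4"
  define X2 where "X2 = (1/2) *\<^sub>R X"
  have sX2: "s *\<^sub>R X2 = (s / 2) *\<^sub>R X" for s by (simp add: X2_def)
  have X2: "norm (exp (s *\<^sub>R X2)) \<le> 1" for s unfolding sX2 by (rule X)
  have neg: "norm (exp (- (s *\<^sub>R Z))) \<le> 1" if "\<And>s::real. norm (exp (s *\<^sub>R Z)) \<le> 1" for s and Z :: 'a
    using that[of "- s"] by simp
  define cY where "cY W s = exp (- (s *\<^sub>R Y)) * W * exp (s *\<^sub>R Y)" for W s
  define cX where "cX W s = exp (s *\<^sub>R X2) * W * exp (- (s *\<^sub>R X2))" for W s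
  have cX': "(cX W has_vector_derivative cX (rcomm X2 W) s) (at s)" for W s
    unfolding cX_def using exp_conj_has_vector_derivative[of "\<lambda>_. W" 0 s X2] by simp
  have cY': "(cY W has_vector_derivative cY (- rcomm Y W) s) (at s)" for W s
    unfolding cY_def using exp_conj_has_vector_derivative[of "\<lambda>_. W" 0 s "- Y"]
    by (simp add: rcomm_def algebra_simps)
  have ncX: "norm (cX W s) \<le> norm W" for W s
    unfolding cX_def by (intro norm_exp_conj_le X2 neg)
  have ncY: "norm (cY W s) \<le> norm W" for W s
    unfolding cY_def using norm_exp_conj_le[of "- (s *\<^sub>R Y)" W] Y neg[OF Y] by simp
  define D where "D s = cY (- rcomm Y X2) s - cX (rcomm X2 Y) s" for s
  \<comment> \<open>With S' and S (X + Y) both written as e^(sX/2) e^(sY) ( ... ) e^(sX/2), this is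
    the difference of their middle factors.\<close>
  define E where "E s = (cY X2 s - X2) + (Y - cX Y s)" for s
  have E': "(E has_vector_derivative D s) (at s)" for s
    unfolding E_def D_def by (auto intro!: derivative_eq_intros cX' cY')
  have D': "(D has_vector_derivative
      cY (- rcomm Y (- rcomm Y X2)) s - cX (rcomm X2 (rcomm X2 Y)) s) (at s)" for s
    unfolding D_def by (auto intro!: derivative_eq_intros cX' cY')
  have "- rcomm Y (- rcomm Y X2) = (1/2) *\<^sub>R rcomm (rcomm X Y) Y"
    "rcomm X2 (rcomm X2 Y) = - ((1/4) *\<^sub>R rcomm (rcomm X Y) X)"
    by (simp_all add: rcomm_def X2_def algebra_simps)
  then have nD': "norm (cY (- rcomm Y (- rcomm Y X2)) s - cX (rcomm X2 (rcomm X2 Y)) s) \<le> c" for s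
    using ncY[of "- rcomm Y (- rcomm Y X2)" s] ncX[of "rcomm X2 (rcomm X2 Y)" s]
    unfolding c_def by (intro order_trans[OF norm_triangle_ineq4] add_mono) auto
  \<comment> \<open>The symmetric placement of X/2 makes the first-order terms of the defect cancel;
    this is where the second order of the formula is gained.\<close>
  have D0: "D 0 = 0" by (simp add: D_def cX_def cY_def rcomm_def)
  have E0: "E 0 = 0" by (simp add: E_def cX_def cY_def)
  have nD: "norm (D s) \<le> c * s" if "s \<ge> 0" for s
    by (rule norm_le_of_vector_derivative_le[where g = "\<lambda>s. c * s", OF D' _ nD' D0 _ that])
      (auto intro!: derivative_eq_intros)
  have nE: "norm (E s) \<le> c * s\<^sup>2 / 2" if "s \<ge> 0" for s
    by (rule norm_le_of_vector_derivative_le[where g = "\<lambda>s. c * s\<^sup>2 / 2", OF E' _ nD E0 _ that])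
      (auto intro!: derivative_eq_intros simp: has_real_derivative_iff_has_vector_derivative[symmetric])
  define S where "S s = exp (s *\<^sub>R X2) * exp (s *\<^sub>R Y) * exp (s *\<^sub>R X2)" for s
  \<comment> \<open>Multiplying by the inverse of the exact flow turns S' - S (X + Y) into the
    derivative of a single function vanishing at 0.\<close>
  define F where "F s = S s * exp (- (s *\<^sub>R (X + Y))) - 1" for s
  define F' where "F' s = exp (s *\<^sub>R X2) * exp (s *\<^sub>R Y) * E s * exp (s *\<^sub>R X2) * exp (- (s *\<^sub>R (X + Y)))" for s
  have eneg: "((\<lambda>s. exp (- (s *\<^sub>R Z))) has_vector_derivative - (Z * exp (- (s *\<^sub>R Z)))) (at s)" for s and Z :: 'a
    using exp_scaleR_has_vector_derivative_left[of "- Z" s] by simp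
  have F': "(F has_vector_derivative F' s) (at s)" for s
  proof -
    have "(F has_vector_derivative
      ((exp (s *\<^sub>R X2) * exp (s *\<^sub>R Y) * (X2 * exp (s *\<^sub>R X2))
        + (exp (s *\<^sub>R X2) * (Y * exp (s *\<^sub>R Y)) + exp (s *\<^sub>R X2) * X2 * exp (s *\<^sub>R Y)) * exp (s *\<^sub>R X2))
         * exp (- (s *\<^sub>R (X + Y)))
       - S s * ((X + Y) * exp (- (s *\<^sub>R (X + Y)))))) (at s)" (is "(_ has_vector_derivative ?d) _")
      unfolding F_def S_def
      by (rule has_vector_derivative_eq_rhs, rule has_vector_derivative_diff, rule has_vector_derivative_mult,
          rule has_vector_derivative_mult, rule has_vector_derivative_mult,
          rule exp_scaleR_has_vector_derivative_right, rule exp_scaleR_has_vector_derivative_left,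
          rule exp_scaleR_has_vector_derivative_left, rule eneg, rule has_vector_derivative_const)
        (simp add: algebra_simps)
    moreover have "?d = F' s"
    proof -
      have YY: "exp (s *\<^sub>R Y) * Y = Y * exp (s *\<^sub>R Y)" by (rule exp_times_scaleR_commute)
      have XX: "exp (s *\<^sub>R X2) * X2 = X2 * exp (s *\<^sub>R X2)" by (rule exp_times_scaleR_commute)
      have YY': "exp (s *\<^sub>R Y) * (Y * z) = Y * (exp (s *\<^sub>R Y) * z)" for z
        using YY by (metis mult.assoc)
      have XX': "exp (s *\<^sub>R X2) * (X2 * z) = X2 * (exp (s *\<^sub>R X2) * z)" for z
        using XX by (metis mult.assoc)
      have X: "X = X2 + X2" by (simp add: X2_def flip: scaleR_add_left)
      show ?thesis
        unfolding F'_def E_def cX_def cY_def S_def X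
        by (simp add: algebra_simps YY' XX' del: scaleR_add_right)
    qed
    ultimately show ?thesis by simp
  qed
  have le1: "norm (z * w) \<le> b" if "norm z \<le> 1" "norm w \<le> b" for z w :: 'a and b
    using that by (meson mult_left_le_one_le norm_ge_zero norm_mult_ineq order_trans)
  have le1': "norm (z * w) \<le> b" if "norm z \<le> b" "norm w \<le> 1" for z w :: 'a and b
    using that by (meson mult_right_le_one_le norm_ge_zero norm_mult_ineq order_trans)
  have nF': "norm (F' s) \<le> c * s\<^sup>2 / 2" if "s \<ge> 0" for s
    using le1'[OF le1'[OF le1[OF X2[of s] le1[OF Y[of s] nE[OF that]]] X2[of s]] neg[OF XY, of s]]
    by (simp add: F'_def mult.assoc)
  have "norm (F t) \<le> c * t ^ 3 / 6"
    by (rule norm_le_of_vector_derivative_le[where g = "\<lambda>s. c * s ^ 3 / 6", OF F' _ nF' _ _ t])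
      (auto intro!: derivative_eq_intros simp: has_real_derivative_iff_has_vector_derivative[symmetric] F_def S_def)
  \<comment> \<open>The exact flow is a contraction, so multiplying back by it preserves the
    bound.\<close>
  then have "norm (- F t * exp (t *\<^sub>R (X + Y))) \<le> c * t ^ 3 / 6"
    by (intro le1' XY) simp
  moreover have "- F t * exp (t *\<^sub>R (X + Y)) = exp (t *\<^sub>R (X + Y)) - S t"
    by (simp add: F_def algebra_simps del: scaleR_add_right)
  ultimately show ?thesis
    by (simp add: c_def S_def sX2 field_simps)
qed


section \<open>Matrices with the operator norm as a Banach algebra\<close>

lemma opnorm_le: "norm (A *v x) \<le> opnorm (A :: 'f::finite op) * norm x"
  unfolding opnorm_def by (rule onorm) simp

lemma opnorm_bound: "(\<And>x. norm (A *v x) \<le> b * norm x) \<Longrightarrow> opnorm (A :: 'f::finite op) \<le> b"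
  unfolding opnorm_def by (rule onorm_le)

lemma scaleR_matrix_vector: "(r *\<^sub>R A) *v x = r *\<^sub>R (A *v x)" for A :: "'f::finite op"
  by (simp add: matrix_vector_mult_def vec_eq_iff scaleR_sum_right)

lemma norm_entry_le_opnorm: "norm (A $ i $ j) \<le> opnorm (A :: 'f::finite op)"
proof -
  have "A $ i $ j = (A *v axis j 1) $ i"
    by (simp add: matrix_vector_mult_def axis_def if_distrib[of "\<lambda>x. _ * x"] cong: if_cong)
  also have "norm \<dots> \<le> norm (A *v axis j 1)" by (rule Finite_Cartesian_Product.norm_nth_le)
  also have "\<dots> \<le> opnorm A * norm (axis j (1::complex) :: complex ^ 'f)" by (rule opnorm_le)
  finally show ?thesis by (simp add: norm_eq_sqrt_inner inner_axis_axis)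
qed

text \<open>
  A copy of the matrix type: on \<open>complex ^ 'f ^ 'f\<close> itself, \<open>*\<close> and \<open>norm\<close> are taken by other
  instances, for which the exponential of a Banach algebra is a different function.
\<close>

typedef 'f cmat = "UNIV :: 'f::finite op set" morphisms op_of cmat ..

setup_lifting type_definition_cmat

instantiation cmat :: (finite) real_normed_algebra_1
begin

lift_definition zero_cmat :: "'a cmat" is 0 .
lift_definition one_cmat :: "'a cmat" is "mat 1" .
lift_definition plus_cmat :: "'a cmat \<Rightarrow> 'a cmat \<Rightarrow> 'a cmat" is "(+)" .
lift_definition minus_cmat :: "'a cmat \<Rightarrow> 'a cmat \<Rightarrow> 'a cmat" is "(-)" .
lift_definition uminus_cmat :: "'a cmat \<Rightarrow> 'a cmat" is uminus .
lift_definition times_cmat :: "'a cmat \<Rightarrow> 'a cmat \<Rightarrow> 'a cmat" is "(**)" .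
lift_definition scaleR_cmat :: "real \<Rightarrow> 'a cmat \<Rightarrow> 'a cmat" is scaleR .
lift_definition norm_cmat :: "'a cmat \<Rightarrow> real" is opnorm .
definition dist_cmat :: "'a cmat \<Rightarrow> 'a cmat \<Rightarrow> real" where "dist_cmat A B = norm (A - B)"
definition sgn_cmat :: "'a cmat \<Rightarrow> 'a cmat" where "sgn_cmat A = inverse (norm A) *\<^sub>R A"
definition uniformity_cmat :: "('a cmat \<times> 'a cmat) filter" where
  "uniformity_cmat = (INF e\<in>{0 <..}. principal {(x, y). dist x y < e})"
definition open_cmat :: "'a cmat set \<Rightarrow> bool" where
  "open_cmat S = (\<forall>x\<in>S. \<forall>\<^sub>F (x', y) in uniformity. x' = x \<longrightarrow> y \<in> S)"

instance
proof
  fix A B C :: "'a cmat" and r s :: real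
  show "A + B + C = A + (B + C)" "A + B = B + A" "0 + A = A" "- A + A = 0" "A - B = A + - B"
    "r *\<^sub>R (A + B) = r *\<^sub>R A + r *\<^sub>R B" "(r + s) *\<^sub>R A = r *\<^sub>R A + s *\<^sub>R A"
    "r *\<^sub>R s *\<^sub>R A = (r * s) *\<^sub>R A" "1 *\<^sub>R A = A"
    by (transfer, simp add: algebra_simps)+
  show "A * B * C = A * (B * C)" "1 * A = A" "A * 1 = A"
    by (transfer, simp add: matrix_mul_assoc)+
  show "(A + B) * C = A * C + B * C" "A * (B + C) = A * B + A * C"
    by (transfer, simp add: matrix_matrix_mult_def vec_eq_iff algebra_simps sum.distrib)+
  show "r *\<^sub>R A * B = r *\<^sub>R (A * B)" "A * r *\<^sub>R B = r *\<^sub>R (A * B)"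
    by (transfer, simp add: matrix_matrix_mult_def vec_eq_iff scaleR_sum_right)+
  show "(0::'a cmat) \<noteq> 1"
    by (transfer, simp add: mat_def vec_eq_iff)
  show "norm A = 0 \<longleftrightarrow> A = 0"
  proof transfer
    fix A :: "'a op"
    show "opnorm A = 0 \<longleftrightarrow> A = 0"
    proof
      assume "opnorm A = 0"
      then have "A $ i $ j = 0" for i j
        by (metis norm_entry_le_opnorm norm_le_zero_iff)
      then show "A = 0" by (simp add: vec_eq_iff)
    next
      show "A = 0 \<Longrightarrow> opnorm A = 0"
        by (simp add: opnorm_def onorm_zero)
    qed
  qed
  show "norm (A + B) \<le> norm A + norm B"
  proof (transfer, rule opnorm_bound)
    fix A B :: "'a op" and x :: "complex ^ 'a"
    have "norm ((A + B) *v x) \<le> norm (A *v x) + norm (B *v x)"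
      by (simp add: matrix_vector_mult_add_rdistrib norm_triangle_ineq)
    also have "\<dots> \<le> (opnorm A + opnorm B) * norm x"
      using opnorm_le[of A x] opnorm_le[of B x] by (simp add: distrib_right)
    finally show "norm ((A + B) *v x) \<le> (opnorm A + opnorm B) * norm x" .
  qed
  show "norm (r *\<^sub>R A) = \<bar>r\<bar> * norm A"
    by (transfer, simp add: opnorm_def scaleR_matrix_vector onorm_scaleR)
  show "norm (A * B) \<le> norm A * norm B"
  proof transfer
    fix A B :: "'a op"
    have "onorm ((*v) A \<circ> (*v) B) \<le> onorm ((*v) A) * onorm ((*v) B)"
      by (rule onorm_compose) simp_all
    then show "opnorm (A ** B) \<le> opnorm A * opnorm B"
      by (simp add: opnorm_def o_def matrix_vector_mul_assoc)
  qed
  show "norm (1::'a cmat) = 1"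
    by (transfer, simp add: opnorm_def onorm_id[unfolded id_def])
  show "dist A B = norm (A - B)" by (fact dist_cmat_def)
  show "sgn A = inverse (norm A) *\<^sub>R A" by (fact sgn_cmat_def)
  show "uniformity = (INF e\<in>{0 <..}. principal {(x, y). dist (x::'a cmat) y < e})"
    by (fact uniformity_cmat_def)
  show "open U \<longleftrightarrow> (\<forall>x\<in>U. \<forall>\<^sub>F (x', y) in uniformity. x' = x \<longrightarrow> y \<in> U)" for U :: "'a cmat set"
    by (fact open_cmat_def)
qed

end

text \<open>With \<open>norm_entry_le_opnorm\<close> this makes convergence in operator norm the
  same as entrywise convergence, so completeness is inherited from the complex numbers.\<close>

lemma norm_cmat_le_entries:
  "norm A \<le> (\<Sum>i\<in>UNIV. \<Sum>j\<in>UNIV. norm (op_of A $ i $ j))"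
proof (transfer, rule opnorm_bound)
  fix A :: "'a op" and x :: "complex ^ 'a"
  have "norm (A *v x) \<le> (\<Sum>i\<in>UNIV. norm ((A *v x) $ i))"
    by (simp add: norm_vec_def L2_set_le_sum)
  also have "\<dots> \<le> (\<Sum>i\<in>UNIV. \<Sum>j\<in>UNIV. norm (A $ i $ j) * norm x)"
    unfolding matrix_vector_mult_def
    by (auto intro!: sum_mono order_trans[OF norm_sum] simp: norm_mult mult_left_mono Finite_Cartesian_Product.norm_nth_le)
  finally show "norm (A *v x) \<le> (\<Sum>i\<in>UNIV. \<Sum>j\<in>UNIV. norm (A $ i $ j)) * norm x"
    by (simp add: sum_distrib_right)
qed

lemma op_of_entry_diff_le: "norm (op_of A $ i $ j - op_of B $ i $ j) \<le> norm (A - B)"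
  by transfer (metis norm_entry_le_opnorm vector_minus_component)

instance cmat :: (finite) banach
proof
  fix X :: "nat \<Rightarrow> 'a cmat"
  assume X: "Cauchy X"
  have "Cauchy (\<lambda>n. op_of (X n) $ i $ j)" for i j
    using X unfolding Cauchy_def dist_norm by (meson le_less_trans op_of_entry_diff_le)
  then have "\<exists>l. (\<lambda>n. op_of (X n) $ i $ j) \<longlonglongrightarrow> l" for i j
    by (simp add: Cauchy_convergent_iff convergent_def)
  then obtain l where l: "\<And>i j. (\<lambda>n. op_of (X n) $ i $ j) \<longlonglongrightarrow> l i j" by metis
  define Y where "Y = cmat (\<chi> i j. l i j)"
  have Y: "op_of (X n - Y) $ i $ j = op_of (X n) $ i $ j - l i j" for n i j
    by (simp add: Y_def minus_cmat.rep_eq cmat_inverse)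
  have "(\<lambda>n. \<Sum>i\<in>UNIV. \<Sum>j\<in>UNIV. norm (op_of (X n - Y) $ i $ j)) 
      \<longlonglongrightarrow> (\<Sum>i\<in>(UNIV::'a set). \<Sum>j\<in>(UNIV::'a set). norm (l i j - l i j))"
    unfolding Y by (intro tendsto_intros l)
  then have "(\<lambda>n. \<Sum>i\<in>UNIV. \<Sum>j\<in>UNIV. norm (op_of (X n - Y) $ i $ j)) \<longlonglongrightarrow> 0"
    by simp
  then have "(\<lambda>n. X n - Y) \<longlonglongrightarrow> 0"
    by (rule Lim_null_comparison[rotated]) (rule always_eventually, rule allI, rule norm_cmat_le_entries)
  then have "X \<longlonglongrightarrow> Y" by (rule LIM_zero_cancel)
  then show "convergent X" by (auto simp: convergent_def)
qed

text \<open>\<open>mexp\<close> sums its series in the topology of the vector type,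
  \<open>exp\<close> in the operator norm; this carries the limit from one to the other.\<close>

lemma op_of_tendsto:
  assumes "X \<longlonglongrightarrow> A" shows "(\<lambda>n. op_of (X n)) \<longlonglongrightarrow> op_of A"
proof (intro vec_tendstoI)
  fix i j
  have "(\<lambda>n. norm (X n - A)) \<longlonglongrightarrow> 0" using assms by (simp add: LIM_zero tendsto_norm_zero)
  then have "(\<lambda>n. op_of (X n) $ i $ j - op_of A $ i $ j) \<longlonglongrightarrow> 0"
    by (rule Lim_null_comparison[rotated]) (rule always_eventually, rule allI, rule op_of_entry_diff_le)
  then show "(\<lambda>n. op_of (X n) $ i $ j) \<longlonglongrightarrow> op_of A $ i $ j"
    by (rule LIM_zero_cancel)
qed

lemma op_of_sum: "op_of (\<Sum>i\<in>I. f i) = (\<Sum>i\<in>I. op_of (f i))"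
  by (induction I rule: infinite_finite_induct) (simp_all add: zero_cmat.rep_eq plus_cmat.rep_eq)

lemma op_of_power: "op_of (A ^ n) = (((**) (op_of A)) ^^ n) (mat 1)"
  by (induction n) (simp_all add: one_cmat.rep_eq times_cmat.rep_eq)

lemma op_of_exp: "op_of (exp A) = mexp (op_of A)"
proof -
  have "(\<lambda>n. op_of (\<Sum>k<n. A ^ k /\<^sub>R fact k)) \<longlonglongrightarrow> op_of (exp A)"
    using exp_converges[of A] unfolding sums_def by (rule op_of_tendsto)
  then have "(\<lambda>n. (1 / fact n) *\<^sub>R (((**) (op_of A)) ^^ n) (mat 1)) sums op_of (exp A)"
    unfolding sums_def by (simp add: op_of_sum scaleR_cmat.rep_eq op_of_power inverse_eq_divide)
  then show ?thesis unfolding mexp_def by (simp add: sums_iff)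
qed

section \<open>Adjoints, the C*-inequality and unitary exponentials\<close>

lift_definition cadj :: "'f::finite cmat \<Rightarrow> 'f cmat" is adj .

text \<open>\<open>inner\<close> is here the real part of the Hermitian product; moving a complex
  factor across it conjugates the factor.\<close>

lemma inner_adj: "(A *v x) \<bullet> y = x \<bullet> (adj A *v y)" for A :: "'f::finite op"
proof -
  have cplx: "(c * d) \<bullet> e = d \<bullet> (cnj c * e)" for c d e :: complex
    by (simp add: inner_complex_def algebra_simps)
  have "(A *v x) \<bullet> y = (\<Sum>i\<in>UNIV. \<Sum>j\<in>UNIV. x $ j \<bullet> (cnj (A $ i $ j) * y $ i))"
    by (simp add: inner_vec_def matrix_vector_mult_def inner_sum_left cplx)
  also have "\<dots> = x \<bullet> (adj A *v y)"
    by (subst sum.swap)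
      (simp add: inner_vec_def matrix_vector_mult_def inner_sum_right adj_def map_matrix_def transpose_def)
  finally show ?thesis .
qed

lemma cadj_simps [simp]:
  "cadj (A + B) = cadj A + cadj B" "cadj (A - B) = cadj A - cadj B" "cadj (- A) = - cadj A"
  "cadj (A * B) = cadj B * cadj A" "cadj (r *\<^sub>R A) = r *\<^sub>R cadj A" "cadj 0 = 0" "cadj 1 = 1"
  "cadj (cadj A) = A"
  by (transfer; simp add: adj_def map_matrix_def transpose_def vec_eq_iff matrix_matrix_mult_def mat_def mult.commute)+

text \<open>The squared length of \<open>A *v x\<close> is the inner product of \<open>x\<close>
  with its image under \<open>adj A ** A\<close>, and Cauchy-Schwarz applies. Through this
  inequality, later norm bounds are read off from algebraic identities.\<close>

lemma norm_square_le_cadj_mult: "(norm A)\<^sup>2 \<le> norm (cadj A * A)"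
proof transfer
  fix A :: "'a op"
  have "norm (A *v x) \<le> sqrt (opnorm (adj A ** A)) * norm x" for x
  proof (rule power2_le_imp_le)
    have "(norm (A *v x))\<^sup>2 = x \<bullet> ((adj A ** A) *v x)"
      by (simp add: power2_norm_eq_inner inner_adj flip: matrix_vector_mul_assoc)
    also have "\<dots> \<le> norm x * norm ((adj A ** A) *v x)" by (rule norm_cauchy_schwarz)
    also have "\<dots> \<le> norm x * (opnorm (adj A ** A) * norm x)" by (intro mult_left_mono opnorm_le) auto
    also have "\<dots> = (sqrt (opnorm (adj A ** A)) * norm x)\<^sup>2"
      by (simp add: power2_eq_square opnorm_def onorm_pos_le)
    finally show "(norm (A *v x))\<^sup>2 \<le> (sqrt (opnorm (adj A ** A)) * norm x)\<^sup>2" .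
  qed (simp add: opnorm_def onorm_pos_le)
  then have "opnorm A \<le> sqrt (opnorm (adj A ** A))" by (rule opnorm_bound)
  then show "(opnorm A)\<^sup>2 \<le> opnorm (adj A ** A)"
    by (simp add: opnorm_def onorm_pos_le real_le_rsqrt sqrt_ge_absD)
qed

text \<open>Cancel one factor \<open>norm A\<close> in the C*-inequality, then use that
  \<open>cadj\<close> is an involution.\<close>

lemma norm_cadj [simp]: "norm (cadj A) = norm A"
proof -
  have "norm A \<le> norm (cadj A)" for A :: "'a cmat"
  proof (cases "A = 0")
    case False
    have "norm A * norm A \<le> norm (cadj A) * norm A"
      using norm_square_le_cadj_mult[of A] norm_mult_ineq[of "cadj A" A] by (simp add: power2_eq_square)
    then show ?thesis using False by simp
  qed simp
  from this[of A] this[of "cadj A"] show ?thesis by simp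
qed

lemma bounded_linear_cadj: "bounded_linear cadj"
  by (rule bounded_linear_intro[where K = 1]) auto

lemma cadj_sum: "cadj (\<Sum>i\<in>I. f i) = (\<Sum>i\<in>I. cadj (f i))"
  by (rule linear_sum[OF bounded_linear.linear[OF bounded_linear_cadj]])

lemma cadj_power: "cadj (A ^ n) = cadj A ^ n"
  by (induction n) (simp_all add: power_commutes)

lemma cadj_exp: "cadj (exp A) = exp (cadj A)"
proof -
  have "(\<lambda>n. cadj (A ^ n /\<^sub>R fact n)) sums cadj (exp A)"
    by (rule bounded_linear.sums[OF bounded_linear_cadj exp_converges])
  then have "(\<lambda>n. cadj A ^ n /\<^sub>R fact n) sums cadj (exp A)" by (simp add: cadj_power)
  then show ?thesis using exp_converges sums_unique2 by blast
qed

lemma norm_le_if_square: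
  assumes "cadj A = A" "A * A = r\<^sup>2 *\<^sub>R 1" "r \<ge> 0"
  shows "norm A \<le> r"
  using norm_square_le_cadj_mult[of A] assms by (simp add: abs_square_le_1)

text \<open>For skew-adjoint \<open>A\<close> the adjoint of the exponential is its inverse.\<close>

lemma norm_exp_le_one:
  assumes "cadj A = - A"
  shows "norm (exp A) \<le> 1"
proof -
  have "cadj (exp A) * exp A = 1"
    using exp_minus_inverse[of "- A"] by (simp add: cadj_exp assms)
  then show ?thesis using norm_square_le_cadj_mult[of "exp A"] by (simp add: abs_square_le_1)
qed

section \<open>Multiplication by the imaginary unit\<close>

lemma mat_mult_nth: "(mat c ** A) $ i $ j = c * A $ i $ j" "(A ** mat c) $ i $ j = A $ i $ j * c"
  for A :: "'f::finite op"
proof -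
  have "(mat c ** A) $ i $ j = (\<Sum>k\<in>UNIV. if i = k then c * A $ k $ j else 0)"
    unfolding matrix_matrix_mult_def mat_def vec_lambda_beta by (intro sum.cong) auto
  then show "(mat c ** A) $ i $ j = c * A $ i $ j" by simp
  have "(A ** mat c) $ i $ j = (\<Sum>k\<in>UNIV. if k = j then A $ i $ k * c else 0)"
    unfolding matrix_matrix_mult_def mat_def vec_lambda_beta by (intro sum.cong) auto
  then show "(A ** mat c) $ i $ j = A $ i $ j * c" by simp
qed

text \<open>\<open>cmat\<close> is set up as a real algebra, so the scalar i enters as this central
  skew-adjoint element.\<close>

lift_definition cI :: "'f::finite cmat" is "mat \<i>" .

lemma cI_simps [simp]: "cI * cI = -1" "cadj cI = - cI"
  by (transfer, simp add: vec_eq_iff mat_mult_nth, simp add: mat_def)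
    (transfer, simp add: vec_eq_iff adj_def transpose_def mat_def map_matrix_def)

lemma cI_commute: "A * cI = cI * A"
  by (transfer, simp add: vec_eq_iff mat_mult_nth)

lemma norm_cI: "norm cI \<le> 1"
  using norm_square_le_cadj_mult[of cI] by (simp add: abs_square_le_1)

lemma norm_cI_mult: "norm (cI * A) = norm A"
proof -
  have le: "norm (cI * A) \<le> norm A" for A :: "'a cmat"
    using norm_mult_ineq[of cI A] norm_cI by (meson mult_left_le_one_le norm_ge_zero order_trans)
  have "cI * (cI * A) = - A" by (simp flip: mult.assoc)
  then show ?thesis using le[of A] le[of "cI * A"] by simp
qed

lemma cscale_i: "cscale (\<i> * of_real t) (op_of A) = op_of (t *\<^sub>R (cI * A))"
proof transfer
  fix t :: real and A :: "'a op"
  show "cscale (\<i> * of_real t) A = t *\<^sub>R (mat \<i> ** A)"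
    by (simp add: cscale_def map_matrix_def vec_eq_iff mat_mult_nth scaleR_conv_of_real[where 'a=complex])
qed

lemma expi_op_of: "expi t (op_of A) = op_of (exp (t *\<^sub>R (cI * A)))"
  by (simp add: cscale_i op_of_exp)

lemma rcomm_cI_mult: "rcomm w (cI * x) = cI * rcomm w x" "rcomm (cI * x) w = cI * rcomm x w"
  by (simp_all add: rcomm_def cI_commute algebra_simps flip: mult.assoc)

lemma rcomm_cadj: "rcomm (cadj x) w = - cadj (rcomm x w)" if "cadj w = w"
  using that by (simp add: rcomm_def)


section \<open>Two orthogonal modes\<close>

lemma norm_square_le: "(norm A)\<^sup>2 \<le> norm (A * A)" if "cadj A = A"
  using norm_square_le_cadj_mult[of A] that by simp

text \<open>\<open>a\<close> is a normalised mode and \<open>g\<close> a field orthogonal to it, of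
  squared length \<gamma>; allowing \<gamma> = 0 covers the zero field.\<close>

locale orthogonal_modes =
  fixes a g :: "'f::finite cmat" and \<gamma> :: real
  assumes aa: "a * a = 0" and gg: "g * g = 0"
    and ga: "g * a = - (a * g)" and gac: "g * cadj a = - (cadj a * g)"
    and aac: "a * cadj a = 1 - cadj a * a" and ggc: "g * cadj g = \<gamma> *\<^sub>R 1 - cadj g * g"
    and nonneg: "\<gamma> \<ge> 0"
begin

abbreviation "z \<equiv> 2 *\<^sub>R (cadj a * a) - 1"
abbreviation "hp \<equiv> cadj a * g + cadj g * a"
abbreviation "hm \<equiv> cadj a * g - cadj g * a"

lemma adjoints:
  "cadj a * cadj a = 0" "cadj g * cadj g = 0" "cadj g * cadj a = - (cadj a * cadj g)"
  "cadj g * a = - (a * cadj g)"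
  using arg_cong[OF aa, of cadj] arg_cong[OF gg, of cadj] arg_cong[OF ga, of cadj] arg_cong[OF gac, of cadj]
  by (simp_all add: equation_minus_iff)

lemmas normal_order0 = aa gg ga gac aac ggc adjoints

text \<open>The relations again for right-nested products. Together with
  \<open>normal_order0\<close> they sort every word into the order \<open>cadj a\<close>,
  \<open>a\<close>, \<open>cadj g\<close>, \<open>g\<close>, so identities reduce to comparing
  normal forms.\<close>

lemma normal_order_assoc:
  "a * (a * x) = 0" "g * (g * x) = 0" "g * (a * x) = - (a * (g * x))" "g * (cadj a * x) = - (cadj a * (g * x))"
  "a * (cadj a * x) = x - cadj a * (a * x)" "g * (cadj g * x) = \<gamma> *\<^sub>R x - cadj g * (g * x)"
  "cadj a * (cadj a * x) = 0" "cadj g * (cadj g * x) = 0" "cadj g * (cadj a * x) = - (cadj a * (cadj g * x))"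
  "cadj g * (a * x) = - (a * (cadj g * x))"
  by (simp_all add: normal_order0 left_diff_distrib flip: mult.assoc)

lemmas normal_order = normal_order0 normal_order_assoc

lemma z_square: "z * z = 1"
  by (simp add: normal_order algebra_simps flip: scaleR_add_left)

text \<open>\<open>hp * hp\<close> is \<open>\<gamma>\<close> times a projection, which is why its norm comes out as \<open>\<gamma>\<close> from the C*-inequality alone.\<close>

lemma norm_hp_square_le: "norm (hp * hp) \<le> \<gamma>"
proof -
  have "hp * hp * (hp * hp) = \<gamma> *\<^sub>R (hp * hp)"
    by (simp add: normal_order algebra_simps)
  moreover have "cadj (hp * hp) = hp * hp" by (simp add: algebra_simps)
  ultimately have "norm (hp * hp) * norm (hp * hp) \<le> \<gamma> * norm (hp * hp)"
    using norm_square_le[of "hp * hp"] nonneg by (simp add: power2_eq_square)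
  then show ?thesis
    by (metis mult_right_le_imp_le nonneg norm_ge_zero order_le_less)
qed

text \<open>The squares of \<open>cadj a * g\<close> and \<open>cadj g * a\<close> vanish, so only
  cross terms survive and the minus sign in \<open>hm\<close> is absorbed by the adjoint.\<close>

lemma norm_hm_le: "norm hm \<le> sqrt \<gamma>"
proof -
  have "cadj hm * hm = hp * hp"
    by (simp add: normal_order algebra_simps)
  then have "(norm hm)\<^sup>2 \<le> \<gamma>"
    using norm_square_le_cadj_mult[of hm] norm_hp_square_le by simp
  then show ?thesis by (rule real_le_rsqrt)
qed

text \<open>\<open>z\<close> anticommutes with \<open>hp\<close> and squares to 1, so the squares
  add without a mixed term.\<close>

lemma norm_z_plus_hp_le: "norm (\<beta> *\<^sub>R z + hp) \<le> sqrt (\<beta>\<^sup>2 + \<gamma>)"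
proof (rule real_le_rsqrt)
  have "(\<beta> *\<^sub>R z + hp) * (\<beta> *\<^sub>R z + hp) = \<beta>\<^sup>2 *\<^sub>R 1 + hp * hp"
    by (simp add: scaleR_2 normal_order algebra_simps power2_eq_square)
  moreover have "cadj (\<beta> *\<^sub>R z + hp) = \<beta> *\<^sub>R z + hp" by (simp add: add.commute)
  ultimately have "(norm (\<beta> *\<^sub>R z + hp))\<^sup>2 \<le> norm (\<beta>\<^sup>2 *\<^sub>R 1 + hp * hp)"
    using norm_square_le[of "\<beta> *\<^sub>R z + hp"] by metis
  also have "\<dots> \<le> \<beta>\<^sup>2 + \<gamma>"
    using norm_triangle_ineq[of "\<beta>\<^sup>2 *\<^sub>R (1::'f cmat)" "hp * hp"] norm_hp_square_le by simp
  finally show "(norm (\<beta> *\<^sub>R z + hp))\<^sup>2 \<le> \<beta>\<^sup>2 + \<gamma>" .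
qed

text \<open>\<open>cadj g * g\<close> squares to \<gamma> times itself; centring it at \<gamma>/2
  leaves an operator whose square is a scalar.\<close>

lemma norm_number_le: "norm (2 *\<^sub>R (cadj g * g) - \<gamma> *\<^sub>R 1) \<le> \<gamma>"
  by (rule norm_le_if_square)
    (simp_all add: nonneg scaleR_2 normal_order algebra_simps power2_eq_square)

end


section \<open>Fermionic modes\<close>

locale fermion_modes =
  fixes M :: "'m set" and a :: "'m \<Rightarrow> 'f::finite cmat"
  assumes finite_modes: "finite M"
    and anti: "\<And>p q. p \<in> M \<Longrightarrow> q \<in> M \<Longrightarrow> a p * a q = - (a q * a p)"
    and mixed: "\<And>p q. p \<in> M \<Longrightarrow> q \<in> M \<Longrightarrow> a p * cadj (a q) = of_bool (p = q) *\<^sub>R 1 - cadj (a q) * a p"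
begin

section \<open>Fields, quadratic operators and their commutators\<close>

definition field_op :: "('m \<Rightarrow> real) \<Rightarrow> 'f cmat" where
  "field_op v = (\<Sum>p\<in>M. v p *\<^sub>R a p)"

definition quadratic_op :: "('m \<Rightarrow> 'm \<Rightarrow> real) \<Rightarrow> 'f cmat" where
  "quadratic_op h = (\<Sum>p\<in>M. \<Sum>q\<in>M. h p q *\<^sub>R (cadj (a p) * a q))"

definition zmode :: "'m \<Rightarrow> 'f cmat" where
  "zmode p = 2 *\<^sub>R (cadj (a p) * a p) - 1"

lemma field_op_anti: "field_op v * field_op w = - (field_op w * field_op v)"
proof -
  have "field_op v * field_op w = (\<Sum>p\<in>M. \<Sum>q\<in>M. v p *\<^sub>R w q *\<^sub>R (a p * a q))"
    by (simp add: field_op_def sum_product mult.commute)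
  also have "\<dots> = (\<Sum>p\<in>M. \<Sum>q\<in>M. - (v p *\<^sub>R w q *\<^sub>R (a q * a p)))"
    by (intro sum.cong refl) (subst anti, simp_all)
  also have "\<dots> = - (field_op w * field_op v)"
    by (subst sum.swap) (simp add: field_op_def sum_product sum_negf mult.commute)
  finally show ?thesis .
qed

text \<open>The anticommutator is the inner product of the coefficient vectors, so orthogonality of
  vectors becomes anticommutation of fields.\<close>

lemma field_op_mixed:
  "field_op v * cadj (field_op w) = (\<Sum>p\<in>M. v p * w p) *\<^sub>R 1 - cadj (field_op w) * field_op v"
proof -
  have "field_op v * cadj (field_op w) = (\<Sum>p\<in>M. \<Sum>q\<in>M. (v p * w q) *\<^sub>R (a p * cadj (a q)))"
    by (simp add: field_op_def sum_product cadj_sum mult.commute)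
  also have "\<dots> = (\<Sum>p\<in>M. \<Sum>q\<in>M. (if p = q then (v p * w p) *\<^sub>R 1 else 0) - (v p * w q) *\<^sub>R (cadj (a q) * a p))"
    by (intro sum.cong refl) (simp add: mixed algebra_simps)
  also have "\<dots> = (\<Sum>p\<in>M. (v p * w p) *\<^sub>R 1) - (\<Sum>p\<in>M. \<Sum>q\<in>M. (v p * w q) *\<^sub>R (cadj (a q) * a p))"
    by (simp add: sum_subtractf finite_modes)
  also have "(\<Sum>p\<in>M. \<Sum>q\<in>M. (v p * w q) *\<^sub>R (cadj (a q) * a p)) = cadj (field_op w) * field_op v"
    by (subst sum.swap) (simp add: field_op_def sum_product cadj_sum)
  finally show ?thesis by (simp add: scaleR_sum_left)
qed

lemma field_op_of_bool: "p \<in> M \<Longrightarrow> field_op (\<lambda>q. of_bool (q = p)) = a p"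
  by (simp add: field_op_def finite_modes of_bool_def if_distrib[of "\<lambda>r. r *\<^sub>R _"] cong: if_cong)

lemma field_op_square: "field_op v * field_op v = 0"
  using field_op_anti[of v v] by (simp add: eq_neg_iff_add_eq_0 flip: scaleR_2)

lemma orthogonal_modes_field_op:
  assumes "p \<in> M" "w p = 0"
  shows "orthogonal_modes (a p) (field_op w) (\<Sum>q\<in>M. (w q)\<^sup>2)"
proof
  have eq: "a p = field_op (\<lambda>q. of_bool (q = p))" using assms by (simp add: field_op_of_bool)
  have 1: "(\<Sum>q\<in>M. w q * of_bool (q = p)) = 0" using assms by (intro sum.neutral) (auto simp: of_bool_def)
  show "a p * a p = 0" unfolding eq by (rule field_op_square)
  show "field_op w * field_op w = 0" by (rule field_op_square)
  show "field_op w * a p = - (a p * field_op w)" unfolding eq by (rule field_op_anti)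
  show "field_op w * cadj (a p) = - (cadj (a p) * field_op w)"
    unfolding eq field_op_mixed[of w] 1 by simp
  show "a p * cadj (a p) = 1 - cadj (a p) * a p" using mixed[of p p] assms by simp
  show "field_op w * cadj (field_op w) = (\<Sum>q\<in>M. (w q)\<^sup>2) *\<^sub>R 1 - cadj (field_op w) * field_op w"
    unfolding field_op_mixed by (simp add: power2_eq_square)
qed (simp add: sum_nonneg)

text \<open>Passing \<open>a r\<close> through a quadratic term changes sign twice, so only the
  contraction with \<open>cadj (a p)\<close> remains. Commuting with \<open>quadratic_op h\<close>
  thus acts on fields through the one-particle matrix \<open>h\<close>.\<close>

lemma rcomm_mode_quadratic:
  assumes "r \<in> M" shows "rcomm (a r) (quadratic_op h) = field_op (h r)"
proof -
  have "rcomm (a r) (cadj (a p) * a q) = of_bool (r = p) *\<^sub>R a q" if "p \<in> M" "q \<in> M" for p q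
  proof -
    have "a r * (cadj (a p) * a q) = (of_bool (r = p) *\<^sub>R 1 - cadj (a p) * a r) * a q"
      using assms that by (simp add: mixed flip: mult.assoc)
    also have "\<dots> = of_bool (r = p) *\<^sub>R a q + cadj (a p) * (a q * a r)"
      using anti[OF assms that(2)] by (simp add: algebra_simps)
    finally show ?thesis by (simp add: rcomm_def mult.assoc)
  qed
  then have "rcomm (a r) (quadratic_op h) = (\<Sum>p\<in>M. \<Sum>q\<in>M. if r = p then h r q *\<^sub>R a q else 0)"
    unfolding quadratic_op_def rcomm_sum rcomm_scaleR by (intro sum.cong refl) auto
  also have "\<dots> = (\<Sum>p\<in>M. if r = p then (\<Sum>q\<in>M. h r q *\<^sub>R a q) else 0)"
    by (intro sum.cong refl) auto
  finally show ?thesis using assms by (simp add: finite_modes field_op_def)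
qed

lemma rcomm_field_quadratic:
  "rcomm (field_op v) (quadratic_op h) = field_op (\<lambda>q. \<Sum>p\<in>M. v p * h p q)"
proof -
  have "rcomm (field_op v) (quadratic_op h) = (\<Sum>p\<in>M. \<Sum>q\<in>M. (v p * h p q) *\<^sub>R a q)"
    unfolding field_op_def[of v] rcomm_sum rcomm_scaleR
    by (intro sum.cong refl) (simp add: rcomm_mode_quadratic field_op_def scaleR_sum_right)
  then show ?thesis
    by (subst (asm) sum.swap) (simp add: field_op_def scaleR_sum_left)
qed

lemma cadj_quadratic:
  assumes "\<And>p q. p \<in> M \<Longrightarrow> q \<in> M \<Longrightarrow> h p q = h q p"
  shows "cadj (quadratic_op h) = quadratic_op h"
proof -
  have "cadj (quadratic_op h) = (\<Sum>p\<in>M. \<Sum>q\<in>M. h q p *\<^sub>R (cadj (a q) * a p))"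
    unfolding quadratic_op_def by (simp add: cadj_sum) (intro sum.cong refl, simp add: assms)
  then show ?thesis unfolding quadratic_op_def by (subst (asm) sum.swap)
qed

section \<open>The operators z and their double commutators\<close>

lemma cadj_zmode [simp]: "cadj (zmode p) = zmode p"
  by (simp add: zmode_def)

lemma zmode_square: "zmode p * zmode p = 1" if "p \<in> M"
proof -
  \<comment> \<open>The zero field is orthogonal to every mode and serves as the second
    field.\<close>
  interpret orthogonal_modes "a p" "field_op (\<lambda>_. 0)" "\<Sum>q\<in>M. (0::real)\<^sup>2"
    by (rule orthogonal_modes_field_op) (use that in auto)
  show ?thesis unfolding zmode_def by (rule z_square)
qed

lemma norm_zmode_le: "norm (zmode p) \<le> 1" if "p \<in> M"
  by (rule norm_le_if_square) (simp_all add: zmode_square that)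

lemma zmode_mode_commute: "zmode p * a q = a q * zmode p" if "p \<in> M" "q \<in> M" "p \<noteq> q"
proof -
  have "a q * (cadj (a p) * a p) = - (cadj (a p) * (a q * a p))"
    using mixed[of q p] that by (simp flip: mult.assoc)
  also have "a q * a p = - (a p * a q)" using anti[of q p] that by simp
  finally show ?thesis by (simp add: zmode_def algebra_simps)
qed

lemma zmode_cadj_mode_commute: "zmode p * cadj (a q) = cadj (a q) * zmode p" if "p \<in> M" "q \<in> M" "p \<noteq> q"
  using arg_cong[OF zmode_mode_commute[OF that], of cadj] by simp

lemma zmode_commute: "zmode p * zmode q = zmode q * zmode p" if "p \<in> M" "q \<in> M"
proof (cases "p = q")
  case False
  have "zmode p * (cadj (a q) * a q) = cadj (a q) * (zmode p * a q)"
    using zmode_cadj_mode_commute[OF that False] by (simp flip: mult.assoc)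
  also have "\<dots> = cadj (a q) * a q * zmode p"
    using zmode_mode_commute[OF that False] by (simp add: mult.assoc)
  finally show ?thesis by (simp add: zmode_def[of q] algebra_simps)
qed simp

lemma rcomm_mode_zmode: "rcomm (a r) (zmode p) = of_bool (p = r) *\<^sub>R (2 *\<^sub>R a r)" if "r \<in> M" "p \<in> M"
proof (cases "p = r")
  case True
  have "a r * (cadj (a r) * a r) = a r - cadj (a r) * (a r * a r)"
    using mixed[of r r] that by (simp add: left_diff_distrib flip: mult.assoc)
  moreover have "a r * a r = 0"
    using anti[of r r] that by (simp add: eq_neg_iff_add_eq_0 flip: scaleR_2)
  ultimately show ?thesis
    using True by (simp add: rcomm_def zmode_def algebra_simps)
next
  case False
  then show ?thesis using zmode_mode_commute[of p r] that by (simp add: rcomm_def)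
qed

lemma field_op_add_scaled: "field_op (\<lambda>q. v q + c * w q) = field_op v + c *\<^sub>R field_op w"
  by (simp add: field_op_def scaleR_add_left sum.distrib scaleR_sum_right)

text \<open>The constant is 6 + 8 + 6: the Leibniz rule gives two terms with both commutators on one
  z, each at most 6 \<beta>, and a product of first commutators bounded by 8 \<beta>.\<close>

proposition norm_double_rcomm_zmode_zmode_le:
  fixes h :: "'m \<Rightarrow> 'm \<Rightarrow> real"
  assumes p: "p \<in> M" and q: "q \<in> M"
    and sym: "\<And>r s. r \<in> M \<Longrightarrow> s \<in> M \<Longrightarrow> h r s = h s r"
    and diag: "\<And>r. r \<in> M \<Longrightarrow> h r r = 0"
    and row: "\<And>r. r \<in> M \<Longrightarrow> (\<Sum>s\<in>M. (h r s)\<^sup>2) = \<beta>"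
    and row2: "\<And>r. r \<in> M \<Longrightarrow> (\<Sum>s\<in>M. (\<Sum>k\<in>M. h r k * h k s)\<^sup>2) \<le> 4 * \<beta>\<^sup>2"
  shows "norm (rcomm (rcomm (zmode p * zmode q) (quadratic_op h)) (quadratic_op h)) \<le> 20 * \<beta>"
proof -
  define H where "H = quadratic_op h"
  define b where "b r = field_op (h r)" for r
  define K where "K r = cadj (a r) * b r - cadj (b r) * a r" for r
  have adjH: "cadj H = H" unfolding H_def using sym by (rule cadj_quadratic)
  have \<beta>: "\<beta> \<ge> 0" using row[OF p] by (metis sum_nonneg zero_le_power2)
  have a_H: "rcomm (a r) H = b r" "rcomm (cadj (a r)) H = - cadj (b r)" if "r \<in> M" for r
    using that by (simp_all add: rcomm_mode_quadratic H_def b_def rcomm_cadj[OF adjH, unfolded H_def])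
  have z_H: "rcomm (zmode r) H = 2 *\<^sub>R K r" if "r \<in> M" for r
    by (simp add: zmode_def K_def rcomm_simps rcomm_scaleR a_H that)
  have K_H: "norm (rcomm (K r) H) \<le> 3 * \<beta>" and K: "norm (K r) \<le> sqrt \<beta>" if r: "r \<in> M" for r
  proof -
    define f where "f s = (\<Sum>k\<in>M. h r k * h k s)" for s
    \<comment> \<open>the part of \<open>f\<close> orthogonal to the mode \<open>r\<close>\<close>
    define g where "g s = f s + (- \<beta>) * of_bool (s = r)" for s
    \<comment> \<open>By symmetry the diagonal entry of the squared matrix is the row sum \<beta>,
      so subtracting \<beta> at \<open>r\<close> removes exactly the component along
      \<open>a r\<close>.\<close>
    have "f r = (\<Sum>k\<in>M. (h r k)\<^sup>2)"
      unfolding f_def by (intro sum.cong refl) (simp add: power2_eq_square sym r)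
    then have fr: "f r = \<beta>" by (rule trans[OF _ row[OF r]])
    then have gr: "g r = 0" by (simp add: g_def)
    interpret g: orthogonal_modes "a r" "field_op g" "\<Sum>s\<in>M. (g s)\<^sup>2"
      using r gr by (rule orthogonal_modes_field_op)
    interpret b: orthogonal_modes "a r" "b r" \<beta>
      unfolding b_def row[OF r, symmetric] using r diag[OF r] by (rule orthogonal_modes_field_op)
    show "norm (K r) \<le> sqrt \<beta>" unfolding K_def by (rule b.norm_hm_le)
    have "(\<Sum>s\<in>M. (f s)\<^sup>2) = \<beta>\<^sup>2 + (\<Sum>s\<in>M - {r}. (f s)\<^sup>2)"
      by (subst sum.remove[OF finite_modes r]) (simp add: fr)
    moreover have "(\<Sum>s\<in>M. (g s)\<^sup>2) = (\<Sum>s\<in>M - {r}. (f s)\<^sup>2)"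
      by (subst sum.remove[OF finite_modes r]) (simp add: g_def fr)
    ultimately have "(\<Sum>s\<in>M. (g s)\<^sup>2) \<le> 3 * \<beta>\<^sup>2"
      using row2[OF r] by (simp add: f_def)
    \<comment> \<open>Of the bound 4 \<beta>^2 on the row of the squared matrix, 3 \<beta>^2 remains
      for \<open>g\<close>, and \<beta>^2 + 3 \<beta>^2 has root 2 \<beta>.\<close>
    then have gb: "sqrt (\<beta>\<^sup>2 + (\<Sum>s\<in>M. (g s)\<^sup>2)) \<le> 2 * \<beta>"
      using \<beta> by (intro real_le_lsqrt) (simp_all add: power_mult_distrib)
    have "field_op g = field_op f + (- \<beta>) *\<^sub>R a r"
      unfolding g_def field_op_add_scaled by (simp add: field_op_of_bool r)
    then have "rcomm (b r) H = field_op g + \<beta> *\<^sub>R a r"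
      unfolding b_def H_def rcomm_field_quadratic f_def[abs_def, symmetric] by simp
    \<comment> \<open>The constant inside \<open>g.z\<close> cancels against the centring of
      \<open>cadj (b r) * b r\<close>; centring both number operators halves their bounds.\<close>
    then have "rcomm (K r) H = (\<beta> *\<^sub>R g.z + g.hp) - (2 *\<^sub>R (cadj (b r) * b r) - \<beta> *\<^sub>R 1)"
      by (simp add: K_def rcomm_simps a_H r rcomm_cadj[OF adjH] scaleR_2 algebra_simps)
    also have "norm \<dots> \<le> 2 * \<beta> + \<beta>"
      by (rule order_trans[OF norm_triangle_ineq4])
        (rule add_mono[OF order_trans[OF g.norm_z_plus_hp_le gb] b.norm_number_le])
    finally show "norm (rcomm (K r) H) \<le> 3 * \<beta>" by simp
  qed
  \<comment> \<open>The mixed product arises twice, each time with a factor 2 from both first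
    commutators, hence 8.\<close>
  have "rcomm (rcomm (zmode p * zmode q) H) H
      = 2 *\<^sub>R (rcomm (K p) H * zmode q) + 8 *\<^sub>R (K p * K q) + 2 *\<^sub>R (zmode p * rcomm (K q) H)"
  proof -
    have "x + x + x + x + x + x + x + x = 8 *\<^sub>R x" for x :: "'f cmat"
      by (simp flip: scaleR_2 scaleR_add_left add: add.assoc)
    then show ?thesis
      using p q by (simp add: rcomm_simps rcomm_scaleR z_H algebra_simps flip: scaleR_add_left)
  qed
  also have "norm \<dots> \<le> 2 * (3 * \<beta> * 1) + 8 * (sqrt \<beta> * sqrt \<beta>) + 2 * (1 * (3 * \<beta>))"
    using norm_mult_le[OF K_H norm_zmode_le] norm_mult_le[OF K K] norm_mult_le[OF norm_zmode_le K_H] p q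
    by (intro order_trans[OF norm_triangle_ineq] add_mono) auto
  also have "\<dots> = 20 * \<beta>" using \<beta> by simp
  finally show ?thesis by (simp add: H_def)
qed

end

text \<open>In the application \<open>bar\<close> flips the spin at a fixed site.\<close>

locale paired_fermion_modes = fermion_modes M a for M :: "'m set" and a :: "'m \<Rightarrow> 'f::finite cmat" +
  fixes bar :: "'m \<Rightarrow> 'm"
  assumes bar_mem [simp]: "\<And>p. p \<in> M \<Longrightarrow> bar p \<in> M"
    and bar_bar [simp]: "\<And>p. bar (bar p) = p"
    and bar_neq: "\<And>p. bar p \<noteq> p"
begin

text \<open>The sum meets every pair \<open>{p, bar p}\<close> twice, hence \<open>1/8\<close> for the \<open>1/4\<close> of the Hubbard interaction.\<close>

definition pair_op :: "'f cmat" where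
  "pair_op = (1 / 8) *\<^sub>R (\<Sum>p\<in>M. zmode p * zmode (bar p))"

lemma cadj_pair_op [simp]: "cadj pair_op = pair_op"
  by (simp add: pair_op_def cadj_sum) (intro sum.cong refl, simp add: zmode_commute)

lemma rcomm_zmode_pair_op: "rcomm (zmode p) pair_op = 0" if "p \<in> M"
proof -
  have "rcomm (zmode p) (zmode q) = 0" if "q \<in> M" for q
    using that \<open>p \<in> M\<close> zmode_commute by (simp add: rcomm_def)
  then show ?thesis by (simp add: pair_op_def rcomm_scaleR rcomm_sum rcomm_simps)
qed

lemma rcomm_mode_pair_op: "rcomm (a r) pair_op = (1 / 2) *\<^sub>R (a r * zmode (bar r))" if r: "r \<in> M"
proof -
  \<comment> \<open>Only the summands at \<open>r\<close> and \<open>bar r\<close> fail to commute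
    with \<open>a r\<close>; each gives 2, and 4/8 = 1/2.\<close>
  have "(\<Sum>p\<in>M. rcomm (a r) (zmode p * zmode (bar p))) =
      (\<Sum>p\<in>M. (if p = r then 2 *\<^sub>R (a r * zmode (bar r)) else 0)
        + (if p = bar r then 2 *\<^sub>R (zmode (bar r) * a r) else 0))"
    using bar_bar by (intro sum.cong refl) (auto simp: rcomm_simps rcomm_mode_zmode r)
  also have "\<dots> = 4 *\<^sub>R (a r * zmode (bar r))"
    using zmode_mode_commute[of "bar r" r] r bar_neq by (simp add: sum.distrib finite_modes flip: scaleR_add_left)
  finally show ?thesis by (simp add: pair_op_def rcomm_scaleR rcomm_sum)
qed

text \<open>Since \<open>q\<close> differs from \<open>bar p\<close>, \<open>zmode (bar p)\<close>
  passes \<open>a q\<close>, and both contributions collect into one factor on the right.\<close>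

lemma rcomm_hop_pair_op:
  assumes p: "p \<in> M" and q: "q \<in> M" and "q \<noteq> bar p"
  shows "rcomm (cadj (a p) * a q) pair_op = cadj (a p) * a q * ((1 / 2) *\<^sub>R (zmode (bar q) - zmode (bar p)))"
proof -
  have 1: "rcomm (cadj (a p)) pair_op = - (1 / 2) *\<^sub>R (cadj (a p) * zmode (bar p))"
    using p zmode_cadj_mode_commute[of "bar p" p] bar_neq by (simp add: rcomm_cadj rcomm_mode_pair_op)
  have "zmode (bar p) * a q = a q * zmode (bar p)"
    by (rule zmode_mode_commute) (use assms in auto)
  then show ?thesis
    by (simp add: rcomm_simps 1 rcomm_mode_pair_op q algebra_simps)
qed

text \<open>Half the difference of two commuting self-adjoint involutions has eigenvalues in {-1, 0,
  1}.\<close>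

lemma zmode_diff_cube:
  assumes "p \<in> M" "q \<in> M"
  defines "w \<equiv> (1 / 2) *\<^sub>R (zmode q - zmode p)"
  shows "w * w * w = w"
proof -
  have 1: "zmode q * zmode p = zmode p * zmode q" "zmode q * (zmode p * x) = zmode p * (zmode q * x)" for x
    using zmode_commute[OF assms(2,1)] by (simp_all flip: mult.assoc)
  have 2: "zmode r * zmode r = 1" "zmode r * (zmode r * x) = x" if "r \<in> M" for r x
    using zmode_square[OF that] by (simp_all flip: mult.assoc)
  have "(zmode q - zmode p) * (zmode q - zmode p) * (zmode q - zmode p) 
      = (zmode q - zmode p) + (zmode q - zmode p) + (zmode q - zmode p) + (zmode q - zmode p)"
    using assms(1,2) by (simp add: algebra_simps 1 2 mult_2)
  also have "\<dots> = 4 *\<^sub>R (zmode q - zmode p)"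
    by (simp flip: scaleR_2 add: add.assoc scaleR_add_left[symmetric] scaleR_diff_right[symmetric])
  finally show ?thesis by (simp add: w_def)
qed

text \<open>On each hopping term the commutator is right multiplication by \<open>w\<close>, which
  itself commutes with \<open>pair_op\<close>; three of them give the cube of \<open>w\<close>,
  which is \<open>w\<close>. The hypothesis excludes hopping onto the partner mode.\<close>

lemma triple_rcomm_pair_op:
  assumes "\<And>p q. p \<in> M \<Longrightarrow> q \<in> M \<Longrightarrow> h p q \<noteq> 0 \<Longrightarrow> q \<noteq> bar p"
  shows "rcomm (rcomm (rcomm (quadratic_op h) pair_op) pair_op) pair_op = rcomm (quadratic_op h) pair_op"
proof -
  have hop: "h p q *\<^sub>R rcomm (rcomm (rcomm (cadj (a p) * a q) pair_op) pair_op) pair_op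
      = h p q *\<^sub>R rcomm (cadj (a p) * a q) pair_op" if p: "p \<in> M" and q: "q \<in> M" for p q
  proof (cases "h p q = 0")
    case False
    define w where "w = (1 / 2) *\<^sub>R (zmode (bar q) - zmode (bar p))"
    define T where "T = cadj (a p) * a q"
    have T: "rcomm T pair_op = T * w"
      unfolding T_def w_def by (rule rcomm_hop_pair_op) (use p q False assms in auto)
    have w: "rcomm w pair_op = 0" by (simp add: w_def rcomm_scaleR rcomm_simps rcomm_zmode_pair_op p q)
    have "w * w * w = w" unfolding w_def by (rule zmode_diff_cube) (simp_all add: p q)
    then have "rcomm (rcomm (rcomm T pair_op) pair_op) pair_op = rcomm T pair_op"
      by (simp add: T w rcomm_simps mult.assoc)
    then show ?thesis by (simp add: T_def)
  qed simp
  show ?thesis unfolding quadratic_op_def rcomm_sum rcomm_scaleR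
    by (intro sum.cong refl hop)
qed

proposition norm_double_rcomm_pair_op_le:
  assumes "\<And>p q. p \<in> M \<Longrightarrow> q \<in> M \<Longrightarrow> h p q \<noteq> 0 \<Longrightarrow> q \<noteq> bar p"
  shows "norm (rcomm (rcomm (quadratic_op h) pair_op) pair_op) \<le> norm (quadratic_op h)"
proof -
  \<comment> \<open>The factor \<open>cI\<close> makes the exponentials unitary, and i^3 = -i turns
    the cube relation into the hypothesis of \<open>norm_double_rcomm_le\<close>.\<close>
  let ?H = "quadratic_op h" and ?X = "cI * pair_op"
  have cc: "cI * (cI * x) = - x" for x :: "'f cmat" by (simp flip: mult.assoc)
  have "norm (rcomm (rcomm ?H ?X) ?X) \<le> norm ?H"
  proof (rule norm_double_rcomm_le)
    show "norm (exp (s *\<^sub>R ?X)) \<le> 1" for s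
      by (rule norm_exp_le_one) (simp add: cI_commute)
    show "rcomm (rcomm (rcomm ?H ?X) ?X) ?X = - rcomm ?H ?X"
      by (simp add: rcomm_cI_mult rcomm_simps(4) triple_rcomm_pair_op[OF assms] cc)
  qed
  then show ?thesis by (simp add: rcomm_cI_mult cc)
qed

text \<open>The bound 20 \<beta> for each mode, summed by the triangle inequality and multiplied by
  the 1/8 in \<open>pair_op\<close>.\<close>

proposition norm_double_rcomm_quadratic_le:
  assumes "\<And>r s. r \<in> M \<Longrightarrow> s \<in> M \<Longrightarrow> h r s = h s r"
    and "\<And>r. r \<in> M \<Longrightarrow> h r r = 0"
    and "\<And>r. r \<in> M \<Longrightarrow> (\<Sum>s\<in>M. (h r s)\<^sup>2) = \<beta>"
    and "\<And>r. r \<in> M \<Longrightarrow> (\<Sum>s\<in>M. (\<Sum>k\<in>M. h r k * h k s)\<^sup>2) \<le> 4 * \<beta>\<^sup>2"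
  shows "norm (rcomm (rcomm pair_op (quadratic_op h)) (quadratic_op h)) \<le> 5 / 2 * \<beta> * card M"
proof -
  have "norm (\<Sum>p\<in>M. rcomm (rcomm (zmode p * zmode (bar p)) (quadratic_op h)) (quadratic_op h)) \<le> real (card M) * (20 * \<beta>)"
    by (rule sum_norm_bound, rule norm_double_rcomm_zmode_zmode_le) (use assms in auto)
  then show ?thesis by (simp add: pair_op_def rcomm_scaleR rcomm_sum mult_ac)
qed

end


section \<open>The Hubbard Hamiltonians\<close>

text \<open>The second bound is maximum times sum: the squared matrix has nonnegative entries of
  size at most d \<tau>^2, and its rows sum to d^2 \<tau>^2. This is insensitive to how many
  two-step paths coincide.\<close>

lemma scaled_adjacency_bounds:
  fixes N :: "'m \<Rightarrow> 'm set" and \<tau> :: real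
  assumes fin: "finite M" and sub: "\<And>r. r \<in> M \<Longrightarrow> N r \<subseteq> M"
    and card: "\<And>r. r \<in> M \<Longrightarrow> card (N r) = d"
    and h: "\<And>r s. r \<in> M \<Longrightarrow> s \<in> M \<Longrightarrow> h r s = (if s \<in> N r then \<tau> else 0)"
    and r: "r \<in> M"
  shows "(\<Sum>s\<in>M. (h r s)\<^sup>2) = d * \<tau>\<^sup>2"
    and "(\<Sum>s\<in>M. (\<Sum>k\<in>M. h r k * h k s)\<^sup>2) \<le> real d ^ 3 * \<tau> ^ 4"
proof -
  have row: "(\<Sum>s\<in>M. if s \<in> N k then c else 0) = d * c" if "k \<in> M" for k and c :: real
    using sub[OF that] card[OF that] fin by (simp add: sum.If_cases Int_absorb1)
  have "(\<Sum>s\<in>M. (h r s)\<^sup>2) = (\<Sum>s\<in>M. if s \<in> N r then \<tau>\<^sup>2 else 0)"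
    by (intro sum.cong refl) (simp add: h r)
  then show "(\<Sum>s\<in>M. (h r s)\<^sup>2) = d * \<tau>\<^sup>2" by (simp add: row r)
  define c where "c s = (\<Sum>k\<in>M. h r k * h k s)" for s
  have hh: "h r k * h k s = (if k \<in> N r then if s \<in> N k then \<tau>\<^sup>2 else 0 else 0)" if "k \<in> M" "s \<in> M" for k s
    using that r by (simp add: h power2_eq_square)
  have c_nonneg: "0 \<le> c s" if "s \<in> M" for s
    unfolding c_def by (intro sum_nonneg) (simp add: hh that)
  have c_le: "c s \<le> d * \<tau>\<^sup>2" if "s \<in> M" for s
  proof -
    have "c s \<le> (\<Sum>k\<in>M. if k \<in> N r then \<tau>\<^sup>2 else 0)"
      unfolding c_def by (intro sum_mono) (simp add: hh that)
    then show ?thesis by (simp add: row r)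
  qed
  have "(\<Sum>s\<in>M. c s) = (\<Sum>k\<in>M. \<Sum>s\<in>M. if k \<in> N r then if s \<in> N k then \<tau>\<^sup>2 else 0 else 0)"
    unfolding c_def by (subst sum.swap) (intro sum.cong refl, simp add: hh)
  also have "\<dots> = (\<Sum>k\<in>M. if k \<in> N r then d * \<tau>\<^sup>2 else 0)"
    by (intro sum.cong refl) (simp add: row)
  also have "\<dots> = d * (d * \<tau>\<^sup>2)" by (simp add: row r)
  finally have c_sum: "(\<Sum>s\<in>M. c s) = d * (d * \<tau>\<^sup>2)" .
  have "(\<Sum>s\<in>M. (c s)\<^sup>2) \<le> (\<Sum>s\<in>M. d * \<tau>\<^sup>2 * c s)"
    unfolding power2_eq_square[of "c _"] by (intro sum_mono mult_right_mono c_le c_nonneg)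
  also have "\<dots> = d * \<tau>\<^sup>2 * (d * (d * \<tau>\<^sup>2))"
    by (simp add: c_sum flip: sum_distrib_left)
  also have "\<dots> = real d ^ 3 * \<tau> ^ 4" by (simp add: power_numeral_reduce)
  finally show "(\<Sum>s\<in>M. (\<Sum>k\<in>M. h r k * h k s)\<^sup>2) \<le> real d ^ 3 * \<tau> ^ 4"
    by (simp add: c_def)
qed

section \<open>Neighbours on the periodic lattice\<close>

definition neighbour_set :: "nat \<Rightarrow> site \<Rightarrow> site set" where
  "neighbour_set L i = {((fst i + 1) mod int L, snd i), ((fst i - 1) mod int L, snd i),
     (fst i, (snd i + 1) mod int L), (fst i, (snd i - 1) mod int L)}"

lemma cong_shift_iff:
  fixes x y d n :: int
  assumes "x \<in> {0..<n}" "y \<in> {0..<n}"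
  shows "[x = y + d] (mod n) \<longleftrightarrow> y = (x - d) mod n"
proof -
  have "[x = y + d] (mod n) \<longleftrightarrow> [y = x - d] (mod n)"
    by (metis add_diff_cancel_right' cong_add_rcancel cong_sym_eq diff_add_cancel)
  also have "\<dots> \<longleftrightarrow> y = (x - d) mod n" using assms by (simp add: cong_def)
  finally show ?thesis .
qed

text \<open>Solving the congruences for reduced residues gives an explicit list of neighbours that
  can be counted.\<close>

lemma nearest_neighbours_iff:
  assumes "i \<in> sites L" "j \<in> sites L"
  shows "nearest_neighbours L i j \<longleftrightarrow> j \<in> neighbour_set L i"
proof -
  obtain x y x' y' where [simp]: "i = (x, y)" "j = (x', y')" by (metis surj_pair)
  have r: "x \<in> {0..<int L}" "y \<in> {0..<int L}" "x' \<in> {0..<int L}" "y' \<in> {0..<int L}"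
    using assms by (auto simp: sites_def)
  have z: "[x = x'] (mod int L) \<longleftrightarrow> x' = x" "[y = y'] (mod int L) \<longleftrightarrow> y' = y"
    using r by (auto simp: cong_def)
  have s: "[x = x' + 1] (mod int L) \<longleftrightarrow> x' = (x - 1) mod int L" "[x = x' - 1] (mod int L) \<longleftrightarrow> x' = (x + 1) mod int L"
    "[y = y' + 1] (mod int L) \<longleftrightarrow> y' = (y - 1) mod int L" "[y = y' - 1] (mod int L) \<longleftrightarrow> y' = (y + 1) mod int L"
    using cong_shift_iff[OF r(1,3), of 1] cong_shift_iff[OF r(2,4), of 1]
      cong_shift_iff[OF r(1,3), of "- 1"] cong_shift_iff[OF r(2,4), of "- 1"]
    by simp_all
  show ?thesis
    by (simp add: nearest_neighbours_def neighbour_set_def z s) blast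
qed

text \<open>The compared numbers differ by 1, 1 and 2, all below \<open>n\<close>; this keeps the
  four neighbours distinct from each other and from the site.\<close>

lemma mod_shift_neq:
  fixes x n :: int
  assumes "n \<ge> 3" "x \<in> {0..<n}"
  shows "(x + 1) mod n \<noteq> x" "(x - 1) mod n \<noteq> x" "(x + 1) mod n \<noteq> (x - 1) mod n"
proof -
  have neq: "a mod n \<noteq> b mod n" if "0 < a - b" "a - b < n" for a b :: int
    using that zdvd_imp_le[of n "a - b"] by (auto simp: mod_eq_dvd_iff)
  have "x mod n = x" using assms by simp
  then show "(x + 1) mod n \<noteq> x" "(x - 1) mod n \<noteq> x" "(x + 1) mod n \<noteq> (x - 1) mod n"
    using neq[of "x + 1" x] neq[of x "x - 1"] neq[of "x + 1" "x - 1"] assms by auto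
qed

lemma neighbour_set:
  assumes "L \<ge> 3" "i \<in> sites L"
  shows "neighbour_set L i \<subseteq> sites L" "i \<notin> neighbour_set L i" "card (neighbour_set L i) = 4"
proof -
  have L: "int L \<ge> 3" using assms by simp
  have r: "fst i \<in> {0..<int L}" "snd i \<in> {0..<int L}" using assms by (auto simp: sites_def)
  note n = mod_shift_neq[OF L r(1)] mod_shift_neq[OF L r(2)]
  show "neighbour_set L i \<subseteq> sites L" using r L by (auto simp: neighbour_set_def sites_def)
  show "i \<notin> neighbour_set L i" using n by (auto simp: neighbour_set_def prod_eq_iff)
  show "card (neighbour_set L i) = 4" using n by (auto simp: neighbour_set_def)
qed

text \<open>The set of offsets is closed under negation.\<close>

lemma nearest_neighbours_sym: "nearest_neighbours L i j \<Longrightarrow> nearest_neighbours L j i"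
proof -
  have c: "[y = x + - d] (mod n)" if "[x = y + d] (mod n)" for x y d n :: int
  proof -
    have "y - (x + - d) = - (x - (y + d))" by simp
    then show ?thesis using that unfolding cong_iff_dvd_diff by (metis dvd_minus_iff)
  qed
  have rev: "[x = y] (mod n) \<Longrightarrow> [y = x] (mod n)" "[x = y + 1] (mod n) \<Longrightarrow> [y = x - 1] (mod n)"
    "[x = y - 1] (mod n) \<Longrightarrow> [y = x + 1] (mod n)" for x y n :: int
    using c[of x y 1 n] c[of x y "- 1" n] by (simp_all add: cong_sym)
  show "nearest_neighbours L i j \<Longrightarrow> nearest_neighbours L j i"
    unfolding nearest_neighbours_def by simp (blast intro: rev)
qed

section \<open>The one-particle hopping matrix\<close>

definition hop_matrix :: "nat \<Rightarrow> real \<Rightarrow> fmode \<Rightarrow> fmode \<Rightarrow> real" where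
  "hop_matrix L \<tau> p q = (if fst p \<noteq> fst q \<and> snd p = snd q then hop_coeff L \<tau> (fst p) (fst q) else 0)"

lemma hop_matrix_eq:
  assumes "L \<ge> 3" "p \<in> modes L" "q \<in> modes L"
  shows "hop_matrix L \<tau> p q = (if q \<in> neighbour_set L (fst p) \<times> {snd p} then \<tau> else 0)"
proof -
  have s: "fst p \<in> sites L" "fst q \<in> sites L" using assms by (auto simp: modes_def)
  show ?thesis
    using neighbour_set(2)[OF assms(1) s(1)]
    by (auto simp: hop_matrix_def hop_coeff_def nearest_neighbours_iff[OF s] mem_Times_iff)
qed

lemma hop_matrix_bounds:
  assumes L: "L \<ge> 3" and p: "p \<in> modes L"
  shows "(\<Sum>q\<in>modes L. (hop_matrix L \<tau> p q)\<^sup>2) = 4 * \<tau>\<^sup>2"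
    and "(\<Sum>q\<in>modes L. (\<Sum>k\<in>modes L. hop_matrix L \<tau> p k * hop_matrix L \<tau> k q)\<^sup>2) \<le> 4 * (4 * \<tau>\<^sup>2)\<^sup>2"
proof -
  have fin: "finite (modes L)" by (simp add: modes_def sites_def)
  have sub: "neighbour_set L (fst p) \<times> {snd p} \<subseteq> modes L"
    and card: "card (neighbour_set L (fst p) \<times> {snd p}) = 4" if "p \<in> modes L" for p
    using neighbour_set[OF L, of "fst p"] that by (auto simp: modes_def card_cartesian_product)
  note * = scaled_adjacency_bounds[OF fin sub card hop_matrix_eq[OF L] p]
  show "(\<Sum>q\<in>modes L. (hop_matrix L \<tau> p q)\<^sup>2) = 4 * \<tau>\<^sup>2" using *(1) by simp
  \<comment> \<open>For d = 4 the bound 4^3 \<tau>^4 is 4 \<beta>^2 with \<beta> = 4 \<tau>^2, as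
    the double commutator estimate requires.\<close>
  show "(\<Sum>q\<in>modes L. (\<Sum>k\<in>modes L. hop_matrix L \<tau> p k * hop_matrix L \<tau> k q)\<^sup>2) \<le> 4 * (4 * \<tau>\<^sup>2)\<^sup>2"
    using *(2) by simp
qed

section \<open>Identification of the two Hamiltonians\<close>

fun flip_spin :: "fmode \<Rightarrow> fmode" where
  "flip_spin (i, Up) = (i, Down)" | "flip_spin (i, Down) = (i, Up)"

lemma cmat_of_CAR:
  assumes "CAR (modes L) a"
  shows "paired_fermion_modes (modes L) (\<lambda>p. cmat (a p)) flip_spin"
proof
  show "finite (modes L)" by (simp add: modes_def sites_def)
  fix p q assume pq: "p \<in> modes L" "q \<in> modes L"
  have "cmat (a p) * cmat (a q) + cmat (a q) * cmat (a p) = 0"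
    using assms pq by (simp add: CAR_def anticomm_def flip: op_of_inject,
      simp add: plus_cmat.rep_eq times_cmat.rep_eq zero_cmat.rep_eq cmat_inverse)
  then show "cmat (a p) * cmat (a q) = - (cmat (a q) * cmat (a p))" by (simp add: eq_neg_iff_add_eq_0)
  have "cmat (a p) * cadj (cmat (a q)) + cadj (cmat (a q)) * cmat (a p) = of_bool (p = q) *\<^sub>R 1"
    using assms pq by (simp add: CAR_def anticomm_def flip: op_of_inject,
      simp add: plus_cmat.rep_eq times_cmat.rep_eq zero_cmat.rep_eq one_cmat.rep_eq scaleR_cmat.rep_eq cadj.rep_eq cmat_inverse)
  then show "cmat (a p) * cadj (cmat (a q)) = of_bool (p = q) *\<^sub>R 1 - cadj (cmat (a q)) * cmat (a p)"
    by (simp add: eq_diff_eq)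
next
  show "flip_spin p \<in> modes L" if "p \<in> modes L" for p
    using that by (cases p rule: flip_spin.cases) (auto simp: modes_def)
  show "flip_spin (flip_spin p) = p" "flip_spin p \<noteq> p" for p
    by (cases p rule: flip_spin.cases; simp)+
qed

lemma H_hop_eq:
  assumes "fermion_modes (modes L) (\<lambda>p. cmat (a p))"
  shows "H_hop L a \<tau> = op_of (fermion_modes.quadratic_op (modes L) (\<lambda>p. cmat (a p)) (hop_matrix L \<tau>))"
proof -
  interpret fermion_modes "modes L" "\<lambda>p. cmat (a p)" by fact
  have fin: "finite (sites L)" by (simp add: sites_def)
  define t where "t i j \<sigma> = hop_coeff L \<tau> i j *\<^sub>R (adj (a (i, \<sigma>)) ** a (j, \<sigma>))" for i j \<sigma>
  have "op_of (quadratic_op (hop_matrix L \<tau>)) = (\<Sum>p\<in>modes L. \<Sum>q\<in>modes L. hop_matrix L \<tau> p q *\<^sub>R (adj (a p) ** a q))"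
    by (simp add: quadratic_op_def op_of_sum scaleR_cmat.rep_eq times_cmat.rep_eq cadj.rep_eq cmat_inverse)
  \<comment> \<open>\<open>hop_matrix\<close> is diagonal in spin, so the second spin sum keeps a
    single term.\<close>
  also have "\<dots> = (\<Sum>i\<in>sites L. \<Sum>\<sigma>\<in>{Up, Down}. \<Sum>j\<in>sites L. \<Sum>\<rho>\<in>{Up, Down}.
      if \<rho> = \<sigma> then if i \<noteq> j then t i j \<sigma> else 0 else 0)"
    unfolding modes_def sum.cartesian_product'
    by (intro sum.cong refl) (auto simp: hop_matrix_def t_def)
  also have "\<dots> = (\<Sum>\<sigma>\<in>{Up, Down}. \<Sum>i\<in>sites L. \<Sum>j\<in>sites L. if i \<noteq> j then t i j \<sigma> else 0)"
    by (subst sum.swap) (intro sum.cong refl, auto)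
  also have "\<dots> = (\<Sum>\<sigma>\<in>{Up, Down}. \<Sum>(i, j)\<in>{(i, j). i \<in> sites L \<and> j \<in> sites L \<and> i \<noteq> j}. t i j \<sigma>)"
  proof (rule sum.cong[OF refl])
    fix \<sigma>
    show "(\<Sum>i\<in>sites L. \<Sum>j\<in>sites L. if i \<noteq> j then t i j \<sigma> else 0)
        = (\<Sum>(i, j)\<in>{(i, j). i \<in> sites L \<and> j \<in> sites L \<and> i \<noteq> j}. t i j \<sigma>)"
      unfolding sum.cartesian_product
      by (rule sum.mono_neutral_cong_right) (use fin in \<open>auto split: if_splits\<close>)
  qed
  finally show ?thesis by (simp add: H_hop_def t_def)
qed

lemma H_int_eq:
  assumes "paired_fermion_modes (modes L) (\<lambda>p. cmat (a p)) flip_spin"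
  shows "H_int L a u = op_of (u *\<^sub>R paired_fermion_modes.pair_op (modes L) (\<lambda>p. cmat (a p)) flip_spin)"
proof -
  interpret paired_fermion_modes "modes L" "\<lambda>p. cmat (a p)" flip_spin by fact
  have z: "z_op a i \<sigma> = op_of (zmode (i, \<sigma>))" for i \<sigma>
    by (simp add: z_op_def number_op_def zmode_def minus_cmat.rep_eq one_cmat.rep_eq scaleR_cmat.rep_eq
        times_cmat.rep_eq cadj.rep_eq cmat_inverse)
  have "(\<Sum>p\<in>modes L. zmode p * zmode (flip_spin p)) = (\<Sum>i\<in>sites L. \<Sum>\<sigma>\<in>{Up, Down}. zmode (i, \<sigma>) * zmode (flip_spin (i, \<sigma>)))"
    by (simp add: modes_def sum.cartesian_product')
  \<comment> \<open>Both spins give the same product, and this factor 2 turns 1/8 into 1/4.\<close>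
  also have "\<dots> = (\<Sum>i\<in>sites L. 2 *\<^sub>R (zmode (i, Up) * zmode (i, Down)))"
  proof (intro sum.cong refl)
    fix i assume "i \<in> sites L"
    then have "zmode (i, Down) * zmode (i, Up) = zmode (i, Up) * zmode (i, Down)"
      by (intro zmode_commute) (auto simp: modes_def)
    then show "(\<Sum>\<sigma>\<in>{Up, Down}. zmode (i, \<sigma>) * zmode (flip_spin (i, \<sigma>))) = 2 *\<^sub>R (zmode (i, Up) * zmode (i, Down))"
      by (simp add: scaleR_2)
  qed
  finally have "u *\<^sub>R pair_op = (u / 4) *\<^sub>R (\<Sum>i\<in>sites L. zmode (i, Up) * zmode (i, Down))"
    by (simp add: pair_op_def flip: scaleR_sum_right)
  then show ?thesis
    by (simp add: H_int_def z op_of_sum scaleR_cmat.rep_eq times_cmat.rep_eq)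
qed

section \<open>Return to matrices and the final estimates\<close>

lemma comm_op_of: "comm (op_of A) (op_of B) = op_of (rcomm A B)"
  by (simp add: comm_def rcomm_def minus_cmat.rep_eq times_cmat.rep_eq)

lemma opnorm_op_of: "opnorm (op_of A) = norm A"
  by (simp add: norm_cmat.rep_eq)

text \<open>The splitting estimate for \<open>cI * A\<close> and \<open>cI * B\<close>, whose
  exponentials are unitary; the factors \<open>cI\<close> come out of the commutators without
  changing norms.\<close>

lemma expi_splitting_error:
  assumes "cadj A = A" "cadj B = B" "t \<ge> 0"
  shows "opnorm (expi t (op_of A + op_of B)
      - expi (t / 2) (op_of A) ** expi t (op_of B) ** expi (t / 2) (op_of A))
    \<le> (1 / 12 * opnorm (comm (comm (op_of A) (op_of B)) (op_of B))
      + 1 / 24 * opnorm (comm (comm (op_of A) (op_of B)) (op_of A))) * t ^ 3"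
proof -
  let ?X = "cI * A" and ?Y = "cI * B"
  have unit: "norm (exp (s *\<^sub>R (cI * C))) \<le> 1" if "cadj C = C" for s and C :: "'a cmat"
    by (rule norm_exp_le_one) (simp add: that cI_commute)
  have "norm (exp (t *\<^sub>R (?X + ?Y)) - exp ((t / 2) *\<^sub>R ?X) * exp (t *\<^sub>R ?Y) * exp ((t / 2) *\<^sub>R ?X))
     \<le> (1 / 12 * norm (rcomm (rcomm ?X ?Y) ?Y) + 1 / 24 * norm (rcomm (rcomm ?X ?Y) ?X)) * t ^ 3"
    by (rule strang_splitting_error) (use assms unit in \<open>auto simp flip: distrib_left\<close>)
  then show ?thesis
    unfolding comm_op_of opnorm_op_of expi_op_of plus_cmat.rep_eq[symmetric]
      times_cmat.rep_eq[symmetric] minus_cmat.rep_eq[symmetric]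
    by (simp add: rcomm_cI_mult norm_cI_mult distrib_left)
qed

theorem theorem1:
  fixes L :: nat and u \<tau> :: real
    and a :: "fmode \<Rightarrow> 'f::finite op"
  assumes "L \<ge> 4" and "u > 0" and "\<tau> > 0"
    and "CARD('f) = 2 ^ (2 * L ^ 2)"
    and "CAR (modes L) a"
  defines "Hh \<equiv> H_hop L a \<tau>" and "HI \<equiv> H_int L a u"
  shows "(\<forall>t\<ge>0. opnorm (expi t (Hh + HI) - expi (t / 2) Hh ** expi t HI ** expi (t / 2) Hh)
             \<le> W_SO1 Hh HI * t ^ 3)
       \<and> (\<forall>t\<ge>0. opnorm (expi t (Hh + HI) - expi (t / 2) HI ** expi t Hh ** expi (t / 2) HI)
             \<le> W_SO2 Hh HI * t ^ 3)
       \<and> W_SO1 Hh HI \<le> u\<^sup>2 / 12 * opnorm Hh + u * \<tau>\<^sup>2 / 12 * (real L)\<^sup>2 * (sqrt 5 + 8)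
       \<and> W_SO2 Hh HI \<le> u * \<tau>\<^sup>2 / 6 * (real L)\<^sup>2 * (sqrt 5 + 8) + u\<^sup>2 / 24 * opnorm Hh"
proof -
  have L: "L \<ge> 3" using assms by simp
  have paired: "paired_fermion_modes (modes L) (\<lambda>p. cmat (a p)) flip_spin"
    by (rule cmat_of_CAR) fact
  interpret paired_fermion_modes "modes L" "\<lambda>p. cmat (a p)" flip_spin by (rule paired)
  define h where "h = hop_matrix L \<tau>"
  define A where "A = quadratic_op h"
  define B where "B = u *\<^sub>R pair_op"
  have Hh: "Hh = op_of A" unfolding Hh_def A_def h_def by (rule H_hop_eq) unfold_locales
  have HI: "HI = op_of B" unfolding HI_def B_def by (rule H_int_eq[OF paired])
  have h_sym: "h p q = h q p" for p q
    using nearest_neighbours_sym by (auto simp: h_def hop_matrix_def hop_coeff_def)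
  have h_diag: "h p p = 0" for p by (simp add: h_def hop_matrix_def)
  have adjA: "cadj A = A" unfolding A_def by (rule cadj_quadratic) (rule h_sym)
  have adjB: "cadj B = B" by (simp add: B_def)
  have flip: "q \<noteq> flip_spin p" if "h p q \<noteq> 0" for p q
    using that by (cases p rule: flip_spin.cases) (auto simp: h_def hop_matrix_def)
  have int2: "norm (rcomm (rcomm A B) B) \<le> u\<^sup>2 * norm A"
  proof -
    have "norm (rcomm (rcomm A pair_op) pair_op) \<le> norm A"
      unfolding A_def by (rule norm_double_rcomm_pair_op_le) (rule flip)
    then show ?thesis using \<open>u > 0\<close> by (simp add: B_def rcomm_scaleR power2_eq_square)
  qed
  have hop2: "norm (rcomm (rcomm B A) A) \<le> 2 * u * \<tau>\<^sup>2 * (real L)\<^sup>2 * (sqrt 5 + 8)"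
  proof -
    \<comment> \<open>With \<beta> = 4 \<tau>^2 and 2 L^2 modes this is 20 \<tau>^2 L^2.\<close>
    have "norm (rcomm (rcomm pair_op A) A) \<le> 5 / 2 * (4 * \<tau>\<^sup>2) * card (modes L)"
      unfolding A_def h_def
      by (rule norm_double_rcomm_quadratic_le)
        (rule h_sym[unfolded h_def] h_diag[unfolded h_def] | erule hop_matrix_bounds[OF L])+
    then have "norm (rcomm (rcomm pair_op A) A) \<le> (2 * \<tau>\<^sup>2 * (real L)\<^sup>2) * 10"
      by (simp add: card_modes)
    \<comment> \<open>The root of 5 is at least 2.\<close>
    also have "\<dots> \<le> (2 * \<tau>\<^sup>2 * (real L)\<^sup>2) * (sqrt 5 + 8)"
      by (intro mult_left_mono) (auto intro: real_le_rsqrt)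
    finally have "u * norm (rcomm (rcomm pair_op A) A) \<le> u * ((2 * \<tau>\<^sup>2 * (real L)\<^sup>2) * (sqrt 5 + 8))"
      using \<open>u > 0\<close> by simp
    then show ?thesis using \<open>u > 0\<close> by (simp add: B_def rcomm_scaleR mult_ac)
  qed
  \<comment> \<open>Exchanging the inner arguments only changes a sign, so both constants are
    combinations of the same two norms.\<close>
  have swap: "norm (rcomm (rcomm x y) w) = norm (rcomm (rcomm y x) w)" for x y w :: "'f cmat"
  proof -
    have "rcomm x y = - rcomm y x" by (simp add: rcomm_def)
    then show ?thesis by (simp add: rcomm_simps(4))
  qed
  have W: "W_SO1 Hh HI = 1 / 12 * norm (rcomm (rcomm A B) B) + 1 / 24 * norm (rcomm (rcomm B A) A)"
    "W_SO2 Hh HI = 1 / 12 * norm (rcomm (rcomm B A) A) + 1 / 24 * norm (rcomm (rcomm A B) B)"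
    unfolding W_SO1_def W_SO2_def Hh HI comm_op_of opnorm_op_of using swap[of A B A] swap[of A B B] by simp_all
  have "opnorm (expi t (Hh + HI) - expi (t / 2) Hh ** expi t HI ** expi (t / 2) Hh) \<le> W_SO1 Hh HI * t ^ 3"
    if "t \<ge> 0" for t
    unfolding W_SO1_def Hh HI using adjA adjB that by (rule expi_splitting_error)
  moreover have "opnorm (expi t (Hh + HI) - expi (t / 2) HI ** expi t Hh ** expi (t / 2) HI) \<le> W_SO2 Hh HI * t ^ 3"
    if "t \<ge> 0" for t
    unfolding W_SO2_def Hh HI add.commute[of "op_of A"] using adjB adjA that by (rule expi_splitting_error)
  moreover have "W_SO1 Hh HI \<le> u\<^sup>2 / 12 * opnorm Hh + u * \<tau>\<^sup>2 / 12 * (real L)\<^sup>2 * (sqrt 5 + 8)"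
    and "W_SO2 Hh HI \<le> u * \<tau>\<^sup>2 / 6 * (real L)\<^sup>2 * (sqrt 5 + 8) + u\<^sup>2 / 24 * opnorm Hh"
    using int2 hop2 unfolding W unfolding Hh opnorm_op_of by (simp_all add: field_simps)
  ultimately show ?thesis by blast
qed

end
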